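(* Let $(S)$ be a connected Hopf SDSE (with $F_i(0,\ldots,0)=1$ for all $i$) containing an $N$-multicyclic SDSE ($N\geq 2$). Then $I$ admits a partition $I=I_{\overline1}\cup\cdots\cup I_{\overline N}$ indexed by $\mathbb Z/N\mathbb Z$ with the following properties: 1. If $x\in I_{\overline k}$, its direct descendants are all in $I_{\overline{k+1}}$. 2. If $x$ and $x'$ have a common direct ascendant, then they have the same direct descendants. Moreover, for all $x\in I$, $$F_x=1+\sum_{x\to y}a^{(x)}_yh_y$$ (sum over the direct descendants $y$ of $x$, with scalars $a^{(x)}_y$), and if $x$ and $x'$ have a common direct ascendant, then $F_x=F_{x'}$.
   Context: $K$ is a field of characteristic zero and $I$ a finite non-empty set. $\mathcal{H}_I$ is the (Connes-Kreimer) polynomial algebra generated by the set of (isomorphism classes of non-planar) rooted trees whose vertices are decorated by elements of $I$; monomials are forests; it is graded by the number of vertices, and $\widehat{\mathcal H_I}=\prod_n\mathcal H_I(n)$ is its completion. The coproduct is the algebra morphism with $\Delta(t)=t\otimes1+1\otimes t+\sum_cP^c(t)\otimes R^c(t)$ for each tree $t$, where $c$ runs over non-empty sets of edges of $t$ such that every path from the root to a leaf meets at most one edge of $c$; after deleting the edges of $c$, $R^c(t)$ is the component containing the root and $P^c(t)$ is the product of the other components. This makes $\mathcal H_I$ a Hopf algebra. $B_i^+$ is the linear (continuous) operator sending a forest to the tree obtained by grafting its trees on a common root decorated by $i$. The SDSE $(S)$ associated to non-constant series $(F_i)_{i\in I}$, $F_i\in K[[h_j,j\in I]]$, is the system $X_i=B_i^+(F_i(X_j,j\in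 I))$, $i\in I$; it has a unique solution $(X_i)_{i\in I}\in\widehat{\mathcal H_I}^{\,I}$. $X_i(n)$ is the homogeneous component of degree $n$ of $X_i$, and $\mathcal H_{(S)}$ is the subalgebra of $\mathcal H_I$ generated by all the $X_i(n)$. $(S)$ is Hopf if $\mathcal H_{(S)}$ is a Hopf subalgebra of $\mathcal H_I$. The graph $G_{(S)}$ has vertex set $I$ and an oriented edge $i\to j$ iff $\partial F_i/\partial h_j\ne0$; then $j$ is a direct descendant of $i$ and $i$ a direct ascendant of $j$. $(S)$ is connected if $G_{(S)}$ is connected (as an undirected graph). An SDSE with index set $I'$ is $N$-multicyclic ($N\ge2$) if $I'$ has a partition $I'=I'_{\overline1}\cup\cdots\cup I'_{\overline N}$ into non-empty sets indexed by $\mathbb Z/N\mathbb Z$ such that, up to a change of variables (replacing $h_j$ by $\lambda_jh_j$ in all series, $\lambda_j\in K-\{0\}$), $F_i=1+\sum_{l\in I'_{\overline{k+1}}}h_l$ for all $\overline k$ and all $i\in I'_{\overline k}$. The SDSE $(S)$ contains an $N$-multicyclic SDSE if for some non-empty $I'\subseteq I$ the restriction of $(S)$ to $I'$, i.e. the system of series $\big(F_i|_{h_j=0,\ \forall j\notin I'}\big)_{i\in I'}$, is $N$-multicyclic. *)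

theory Defs
  imports
    "HOL-Library.Multiset"
    "HOL-Library.Poly_Mapping"
    "HOL-Library.Product_Plus"
    "HOL-Computational_Algebra.Formal_Power_Series"
begin

unbundle fps_syntax

section \<open>Decorated rooted trees and forests\<close>

datatype 'i rtree = Node 'i "'i rtree multiset"

type_synonym 'i forest = "'i rtree multiset"

primrec nverts :: "'i rtree \<Rightarrow> nat" where
  "nverts (Node i ts) = Suc (\<Sum>\<^sub># (image_mset nverts ts))"

definition forest_deg :: "'i forest \<Rightarrow> nat" where
  "forest_deg f = (\<Sum>t\<in>#f. nverts t)"

text \<open>Plane trees serve to address the individual edges of a non-planar tree; sums over edge sets
  of a tree do not depend on the plane representative chosen for it.\<close>

datatype 'a ptree = PNode 'a "'a ptree list"

primrec plabel :: "'a ptree \<Rightarrow> 'a" where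
  "plabel (PNode a ps) = a"

primrec shape :: "'i ptree \<Rightarrow> 'i rtree" where
  "shape (PNode i ps) = Node i (mset (map shape ps))"

section \<open>The algebra of forests\<close>

text \<open>The polynomial algebra on the set of trees is the monoid algebra of the free commutative
  monoid of forests, and its tensor square is the monoid algebra of pairs of forests, with
  the pair of forests \<open>(f, g)\<close> standing for \<open>f \<otimes> g\<close>.\<close>

type_synonym ('i, 'k) ck = "'i forest \<Rightarrow>\<^sub>0 'k"
type_synonym ('i, 'k) ck2 = "('i forest \<times> 'i forest) \<Rightarrow>\<^sub>0 'k"

definition scale :: "'k::field \<Rightarrow> ('b::comm_monoid_add \<Rightarrow>\<^sub>0 'k) \<Rightarrow> ('b \<Rightarrow>\<^sub>0 'k)" where
  "scale c x = Poly_Mapping.single 0 c * x"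

global_interpretation ck: vector_space "scale :: 'k::field \<Rightarrow> ('b::comm_monoid_add \<Rightarrow>\<^sub>0 'k) \<Rightarrow> _"
  defines ck_span = ck.span and ck_subspace = ck.subspace
  by unfold_locales
    (simp_all add: scale_def algebra_simps single_add mult_single flip: mult.assoc)

definition lin_ext :: "('b \<Rightarrow> ('c::comm_monoid_add \<Rightarrow>\<^sub>0 'k::field)) \<Rightarrow> ('b \<Rightarrow>\<^sub>0 'k) \<Rightarrow> ('c \<Rightarrow>\<^sub>0 'k)" where
  "lin_ext g x = (\<Sum>b\<in>Poly_Mapping.keys x. scale (Poly_Mapping.lookup x b) (g b))"

definition forest_el :: "'b \<Rightarrow> ('b \<Rightarrow>\<^sub>0 'k::field)" where
  "forest_el b = Poly_Mapping.single b 1"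

definition tensor :: "('i, 'k::field) ck \<Rightarrow> ('i, 'k) ck \<Rightarrow> ('i, 'k) ck2" where
  "tensor x y = lin_ext (\<lambda>f. lin_ext (\<lambda>g. forest_el (f, g)) y) x"

definition homogeneous :: "nat \<Rightarrow> ('i, 'k::field) ck \<Rightarrow> bool" where
  "homogeneous n x \<longleftrightarrow> (\<forall>f\<in>Poly_Mapping.keys x. forest_deg f = n)"

section \<open>The Connes--Kreimer coproduct\<close>

text \<open>A set of edges of a plane tree is encoded by marking vertices with a boolean: a marked
  non-root vertex means that the edge to its parent is in the set, and the root is unmarked.
  Paths from the root to the leaves are recorded by the marks of their vertices.\<close>

fun path_marks :: "('i \<times> bool) ptree \<Rightarrow> bool list set" where
  "path_marks (PNode a ps) =
     (if ps = [] then {[snd a]} else (#) (snd a) ` (\<Union>(path_marks ` set ps)))"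

definition marked_edges :: "('i \<times> bool) ptree \<Rightarrow> bool" where
  "marked_edges q \<longleftrightarrow> (\<exists>a\<in>set_ptree q. snd a)"

definition cuts :: "'i ptree \<Rightarrow> ('i \<times> bool) ptree set" where
  "cuts p = {q. map_ptree fst q = p \<and> \<not> snd (plabel q) \<and> marked_edges q \<and>
                (\<forall>bs\<in>path_marks q. length (filter id bs) \<le> 1)}"

text \<open>\<open>trunk q\<close> is the component of the root after deletion of the marked edges, and
  \<open>branches q\<close> is the forest of all the other components.\<close>

fun trunk :: "('i \<times> bool) ptree \<Rightarrow> 'i rtree" where
  "trunk (PNode a ps) =
     Node (fst a) (mset (map trunk (filter (\<lambda>q. \<not> snd (plabel q)) ps)))"

fun branches :: "('i \<times> bool) ptree \<Rightarrow> 'i forest" where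
  "branches (PNode a ps) =
     (\<Sum>q\<leftarrow>ps. branches q + (if snd (plabel q) then {#trunk q#} else {#}))"

definition coprod_tree :: "'i rtree \<Rightarrow> ('i, 'k::field) ck2" where
  "coprod_tree t =
     forest_el ({#t#}, {#}) + forest_el ({#}, {#t#}) +
     (\<Sum>q\<in>cuts (SOME p. shape p = t). forest_el (branches q, {#trunk q#}))"

definition coprod :: "('i, 'k::field) ck \<Rightarrow> ('i, 'k) ck2" where
  "coprod = lin_ext (\<lambda>f. \<Prod>t\<in>#f. coprod_tree t)"

section \<open>Hopf subalgebras\<close>

definition counit :: "('i, 'k::field) ck \<Rightarrow> 'k" where
  "counit x = Poly_Mapping.lookup x {#}"

definition convolution ::
  "(('i, 'k::field) ck \<Rightarrow> ('i, 'k) ck) \<Rightarrow> (('i, 'k) ck \<Rightarrow> ('i, 'k) ck) \<Rightarrow> ('i, 'k) ck \<Rightarrow> ('i, 'k) ck"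
  where "convolution u v x =
     lin_ext (\<lambda>(f, g). u (forest_el f) * v (forest_el g)) (coprod x)"

definition is_antipode :: "(('i, 'k::field) ck \<Rightarrow> ('i, 'k) ck) \<Rightarrow> bool" where
  "is_antipode S \<longleftrightarrow> Vector_Spaces.linear scale scale S \<and>
     (\<forall>x. convolution S id x = scale (counit x) 1 \<and> convolution id S x = scale (counit x) 1)"

definition antipode :: "('i, 'k::field) ck \<Rightarrow> ('i, 'k) ck" where
  "antipode = (THE S. is_antipode S)"

definition subalgebra :: "('i, 'k::field) ck set \<Rightarrow> bool" where
  "subalgebra A \<longleftrightarrow> ck_subspace A \<and> 1 \<in> A \<and> (\<forall>x\<in>A. \<forall>y\<in>A. x * y \<in> A)"

definition hopf_subalgebra :: "('i, 'k::field) ck set \<Rightarrow> bool" where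
  "hopf_subalgebra A \<longleftrightarrow> subalgebra A \<and>
     coprod ` A \<subseteq> ck_span {tensor x y | x y. x \<in> A \<and> y \<in> A} \<and> antipode ` A \<subseteq> A"

section \<open>Systems of Dyson--Schwinger equations\<close>

text \<open>A series in the variables \<open>h\<^sub>j\<close> is the function giving the coefficient of each
  monomial, a monomial being the multiset of the indices of its variables.\<close>

type_synonym ('i, 'k) series = "'i multiset \<Rightarrow> 'k"

definition nonconstant :: "('i, 'k::field) series \<Rightarrow> bool" where
  "nonconstant s \<longleftrightarrow> (\<exists>m. m \<noteq> {#} \<and> s m \<noteq> 0)"

definition series_deriv :: "'i \<Rightarrow> ('i, 'k::field) series \<Rightarrow> ('i, 'k) series" where
  "series_deriv j s = (\<lambda>m. of_nat (Suc (count m j)) * s (add_mset j m))"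

definition rescale :: "('i \<Rightarrow> 'k::field) \<Rightarrow> ('i, 'k) series \<Rightarrow> ('i, 'k) series" where
  "rescale l s = (\<lambda>m. (\<Prod>j\<in>#m. l j) * s m)"

definition restrict_series :: "'i set \<Rightarrow> ('i, 'k::field) series \<Rightarrow> ('i, 'k) series" where
  "restrict_series J s = (\<lambda>m. if set_mset m \<subseteq> J then s m else 0)"

text \<open>The series \<open>1 + (\<Sum>j\<in>J. a j * h\<^sub>j)\<close>.\<close>

definition one_plus_linear :: "'i set \<Rightarrow> ('i \<Rightarrow> 'k::field) \<Rightarrow> ('i, 'k) series" where
  "one_plus_linear J a =
     (\<lambda>m. (if m = {#} then 1 else 0) + (\<Sum>j\<in>J. a j * (if m = {#j#} then 1 else 0)))"

text \<open>An element of the completion \<open>\<Prod>\<^sub>n H(n)\<close> is represented by a formal power series over the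
  algebra whose coefficient of order \<open>n\<close> is its homogeneous component of degree \<open>n\<close>.\<close>

type_synonym ('i, 'k) ck_hat = "('i, 'k) ck fps"

definition in_completion :: "('i, 'k::field) ck_hat \<Rightarrow> bool" where
  "in_completion x \<longleftrightarrow> (\<forall>n. homogeneous n (x $ n))"

definition graft :: "'i \<Rightarrow> ('i, 'k::field) ck \<Rightarrow> ('i, 'k) ck" where
  "graft i = lin_ext (\<lambda>f. forest_el {#Node i f#})"

definition graft_hat :: "'i \<Rightarrow> ('i, 'k::field) ck_hat \<Rightarrow> ('i, 'k) ck_hat" where
  "graft_hat i x = Abs_fps (\<lambda>n. if n = 0 then 0 else graft i (x $ (n - 1)))"

text \<open>Meant for finitely many variables and families \<open>X\<close> without constant terms (such is every
  image of \<open>graft_hat\<close>): then the index set of the sum is finite for every \<open>n\<close>.\<close>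

definition series_subst :: "('i, 'k::field) series \<Rightarrow> ('i \<Rightarrow> ('i, 'k) ck_hat) \<Rightarrow> ('i, 'k) ck_hat" where
  "series_subst s X = Abs_fps (\<lambda>n. \<Sum>m | s m \<noteq> 0 \<and> (\<Prod>j\<in>#m. X j) $ n \<noteq> 0.
     scale (s m) ((\<Prod>j\<in>#m. X j) $ n))"

definition sdse_solves :: "('i \<Rightarrow> ('i, 'k::field) series) \<Rightarrow> ('i \<Rightarrow> ('i, 'k) ck_hat) \<Rightarrow> bool" where
  "sdse_solves F X \<longleftrightarrow>
     (\<forall>i. in_completion (X i)) \<and> (\<forall>i. X i = graft_hat i (series_subst (F i) X))"

definition sdse_solution :: "('i \<Rightarrow> ('i, 'k::field) series) \<Rightarrow> 'i \<Rightarrow> ('i, 'k) ck_hat" where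
  "sdse_solution F = (THE X. sdse_solves F X)"

definition sdse_algebra :: "('i \<Rightarrow> ('i, 'k::field) series) \<Rightarrow> ('i, 'k) ck set" where
  "sdse_algebra F = subalgebra hull {sdse_solution F i $ n | i n. True}"

definition hopf_sdse :: "('i \<Rightarrow> ('i, 'k::field) series) \<Rightarrow> bool" where
  "hopf_sdse F \<longleftrightarrow> hopf_subalgebra (sdse_algebra F)"

section \<open>The graph of a system, multicyclic systems\<close>

definition sdse_edges :: "('i \<Rightarrow> ('i, 'k::field) series) \<Rightarrow> ('i \<times> 'i) set" where
  "sdse_edges F = {(i, j). series_deriv j (F i) \<noteq> (\<lambda>_. 0)}"

definition descendants :: "('i \<Rightarrow> ('i, 'k::field) series) \<Rightarrow> 'i \<Rightarrow> 'i set" where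
  "descendants F i = {j. (i, j) \<in> sdse_edges F}"

definition sdse_connected :: "('i \<Rightarrow> ('i, 'k::field) series) \<Rightarrow> bool" where
  "sdse_connected F \<longleftrightarrow> (\<forall>i j. (i, j) \<in> (sdse_edges F \<union> (sdse_edges F)\<inverse>)\<^sup>*)"

text \<open>Residue classes modulo \<open>N\<close> are represented by \<open>0, \<dots>, N - 1\<close>.\<close>

definition cyclic_partition :: "nat \<Rightarrow> 'i set \<Rightarrow> (nat \<Rightarrow> 'i set) \<Rightarrow> bool" where
  "cyclic_partition N J P \<longleftrightarrow> (\<Union>k<N. P k) = J \<and> (\<forall>k<N. P k \<noteq> {}) \<and>
     (\<forall>k<N. \<forall>l<N. k \<noteq> l \<longrightarrow> P k \<inter> P l = {})"

definition multicyclic :: "nat \<Rightarrow> 'i set \<Rightarrow> ('i \<Rightarrow> ('i, 'k::field) series) \<Rightarrow> bool" where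
  "multicyclic N J G \<longleftrightarrow> (\<exists>P l. cyclic_partition N J P \<and> (\<forall>j\<in>J. l j \<noteq> 0) \<and>
     (\<forall>k<N. \<forall>i\<in>P k. rescale l (G i) = one_plus_linear (P (Suc k mod N)) (\<lambda>_. 1)))"

definition contains_multicyclic :: "nat \<Rightarrow> ('i \<Rightarrow> ('i, 'k::field) series) \<Rightarrow> bool" where
  "contains_multicyclic N F \<longleftrightarrow>
     (\<exists>J. J \<noteq> {} \<and> multicyclic N J (\<lambda>i. restrict_series J (F i)))"

end

theory Submission
  imports Defs "HOL-Number_Theory.Cong"
begin

text \<open>Comparing the terms of the coproduct of \<open>X\<^sub>i(n + 1)\<close> whose left factor is a single vertex
  decorated by \<open>j\<close> with \<open>X\<^sub>i(n)\<close> yields scalars \<open>\<lambda>\<^sub>n(i, j)\<close> with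
  \<open>\<lambda>\<^sub>n(i, j) F\<^sub>i(m) = (m\<^sub>j + 1) F\<^sub>i(m + j) + F\<^sub>i(m) \<Sum>\<^sub>s \<lambda>\<^bsub>|s|\<^esub>(root s, j)\<close>
  for every tree with \<open>n\<close> vertices, root \<open>i\<close> and branches \<open>s\<close> of nonzero coefficients, the
  multiset of the roots of the branches being \<open>m\<close>. Along an edge \<open>i \<rightarrow> k\<close> the sequences
  \<open>\<lambda>\<^sub>n\<^sub>+\<^sub>1(i, j)\<close> and \<open>\<lambda>\<^sub>n(k, j)\<close> therefore differ by a constant. For \<open>i\<close> and \<open>j\<close> in the
  multicyclic part, \<open>\<lambda>\<^sub>n(i, j)\<close> is a nonzero multiple of the indicator function of a residue
  class modulo \<open>N\<close>. By connectedness it is, for every \<open>i\<close>, eventually a constant plus such an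
  indicator, and the class gives the partition. A quadratic term of \<open>F\<^sub>i\<close> would give trees
  consisting of two long ladders joined at the root, and the sum of two such sequences is
  incompatible with the indicator of a single class.\<close>

section \<open>Coefficients of linear extensions, products and grafts\<close>

abbreviation lookup where "lookup \<equiv> Poly_Mapping.lookup"

lemma lookup_scale: "lookup (scale c x) b = c * lookup x b"
proof -
  have "scale c x = Poly_Mapping.map ((*) c) x"
    unfolding scale_def by (rule mult_map_scale_conv_mult[symmetric])
  then show ?thesis by (simp add: Poly_Mapping.map.rep_eq when_def)
qed

text \<open>The finite set \<open>B\<close> is left free so that a basis element of interest can be
  added to the support before one summand is picked out.\<close>

lemma lookup_lin_ext:
  assumes "finite B" "Poly_Mapping.keys x \<subseteq> B"
  shows "lookup (lin_ext g x) c = (\<Sum>b\<in>B. lookup x b * lookup (g b) c)"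
proof -
  have "lookup (lin_ext g x) c = (\<Sum>b\<in>Poly_Mapping.keys x. lookup x b * lookup (g b) c)"
    by (simp add: lin_ext_def lookup_sum lookup_scale)
  also have "\<dots> = (\<Sum>b\<in>B. lookup x b * lookup (g b) c)"
    using assms by (intro sum.mono_neutral_left) (auto simp: in_keys_iff)
  finally show ?thesis .
qed

lemma lookup_single_mult:
  fixes y :: "'a multiset \<Rightarrow>\<^sub>0 'k::semiring_0"
  shows "lookup (Poly_Mapping.single b c * y) f = (if b \<subseteq># f then c * lookup y (f - b) else 0)"
proof -
  have "lookup (Poly_Mapping.single b c * y) f =
      Sum_any (\<lambda>a. (c when b = a) * Sum_any (\<lambda>q. lookup y q when f = a + q))"
    by (simp add: lookup_mult lookup_single)
  also have "\<dots> = c * Sum_any (\<lambda>q. lookup y q when f = b + q)"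
    by (simp add: when_mult)
  also have "Sum_any (\<lambda>q. lookup y q when f = b + q) = (if b \<subseteq># f then lookup y (f - b) else 0)"
  proof (cases "b \<subseteq># f")
    case True
    then have "f = b + q \<longleftrightarrow> q = f - b" for q by auto
    then show ?thesis using True by simp
  next
    case False
    then have "f \<noteq> b + q" for q by auto
    then show ?thesis using False by simp
  qed
  finally show ?thesis by simp
qed

lemma poly_mapping_sum_single:
  "x = (\<Sum>b\<in>Poly_Mapping.keys x. Poly_Mapping.single b (lookup x b))"
  by (rule poly_mapping_eqI)
    (simp add: lookup_sum lookup_single when_def in_keys_iff)

text \<open>A one-tree forest factors only trivially, so the coefficient of a tree is a derivation
  relative to the counit. This lets conditions on tree coefficients survive products.\<close>

lemma lookup_mult_tree:
  fixes x y :: "('i, 'k::field) ck"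
  shows "lookup (x * y) {#t#} = lookup x {#} * lookup y {#t#} + lookup x {#t#} * lookup y {#}"
proof -
  let ?h = "\<lambda>b. if b \<subseteq># {#t#} then lookup x b * lookup y ({#t#} - b) else 0"
  have "x * y = (\<Sum>b\<in>Poly_Mapping.keys x. Poly_Mapping.single b (lookup x b) * y)"
    by (subst poly_mapping_sum_single[of x]) (rule sum_distrib_right)
  then have "lookup (x * y) {#t#} = (\<Sum>b\<in>Poly_Mapping.keys x. ?h b)"
    by (simp add: lookup_sum lookup_single_mult)
  also have "\<dots> = (\<Sum>b\<in>Poly_Mapping.keys x \<union> {{#}, {#t#}}. ?h b)"
    by (rule sum.mono_neutral_left) (auto simp: in_keys_iff)
  also have "\<dots> = (\<Sum>b\<in>{{#}, {#t#}}. ?h b)"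
    by (rule sum.mono_neutral_right) (auto dest: nonempty_subseteq_mset_eq_single)
  finally show ?thesis by simp
qed

lemma lookup_graft_tree: "lookup (graft i x) {#Node i' f#} = of_bool (i = i') * lookup x f"
proof -
  have "lookup (graft i x) {#Node i' f#} =
      (\<Sum>b\<in>insert f (Poly_Mapping.keys x). lookup x b * lookup (forest_el {#Node i b#}) {#Node i' f#})"
    unfolding graft_def by (rule lookup_lin_ext) auto
  also have "\<dots> = (\<Sum>b\<in>insert f (Poly_Mapping.keys x). if b = f then of_bool (i = i') * lookup x f else 0)"
    by (rule sum.cong) (auto simp: forest_el_def lookup_single when_def)
  finally show ?thesis by simp
qed

lemma lookup_graft_other: "\<nexists>t. g = {#t#} \<Longrightarrow> lookup (graft i x) g = 0"
  by (subst graft_def, subst lookup_lin_ext[OF finite_keys subset_refl])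
    (auto simp: forest_el_def lookup_single when_def intro!: sum.neutral)

section \<open>Trees of bounded degree\<close>

primrec rlabel :: "'i rtree \<Rightarrow> 'i" where
  "rlabel (Node i f) = i"

abbreviation rlabels :: "'i forest \<Rightarrow> 'i multiset" where
  "rlabels f \<equiv> image_mset rlabel f"

lemma nverts_pos: "nverts t > 0"
  by (cases t) simp

lemma nverts_Node: "nverts (Node i f) = Suc (forest_deg f)"
  by (simp add: forest_deg_def)

lemma forest_deg_simps [simp]:
  "forest_deg {#} = 0" "forest_deg (add_mset t f) = nverts t + forest_deg f"
  "forest_deg (f + g) = forest_deg f + forest_deg g"
  by (simp_all add: forest_deg_def)

lemma size_le_forest_deg: "size f \<le> forest_deg f"
proof (induction f)
  case (add t f)
  then show ?case using nverts_pos[of t] by simp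
qed simp

lemma nverts_le_forest_deg: "t \<in># f \<Longrightarrow> nverts t \<le> forest_deg f"
  by (metis forest_deg_simps(2) insert_DiffM le_add1)

lemma forest_deg_remove: "t \<in># f \<Longrightarrow> nverts t + forest_deg (f - {#t#}) = forest_deg f"
  by (metis forest_deg_simps(2) insert_DiffM)

text \<open>Trees and forests are treated together: a tree is a root over a forest of smaller
  degree, and a forest of bounded degree is a multiset of boundedly many bounded trees.\<close>

lemma finite_trees_le: "finite {t :: 'i::finite rtree. nverts t \<le> n}"
  and finite_forests_le: "finite {f :: 'i::finite forest. forest_deg f \<le> n}"
proof (induction n)
  case 0
  {
    case 1
    have "{t :: 'i rtree. nverts t \<le> 0} = {}" using nverts_pos by (auto simp: not_le)
    then show ?case by (simp only: finite.emptyI)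
  next
    case 2
    have "{f :: 'i forest. forest_deg f \<le> 0} \<subseteq> {{#}}"
    proof
      fix f :: "'i forest" assume "f \<in> {f. forest_deg f \<le> 0}"
      then show "f \<in> {{#}}" using size_le_forest_deg[of f] by simp
    qed
    then show ?case by (rule finite_subset) simp
  }
next
  case (Suc n)
  \<comment> \<open>The tree bound comes first because the forest bound at the same degree relies on
    it.\<close>
  have trees: "finite {t :: 'i rtree. nverts t \<le> Suc n}"
  proof -
    have "{t :: 'i rtree. nverts t \<le> Suc n} \<subseteq>
        (\<lambda>(i, f). Node i f) ` (UNIV \<times> {f. forest_deg f \<le> n})"
    proof
      fix t :: "'i rtree" assume "t \<in> {t. nverts t \<le> Suc n}"
      then show "t \<in> (\<lambda>(i, f). Node i f) ` (UNIV \<times> {f. forest_deg f \<le> n})"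
        by (cases t) (auto simp: forest_deg_def)
    qed
    then show ?thesis by (rule finite_subset) (simp add: Suc)
  qed
  {
    case 1
    show ?case by (rule trees)
  next
    case 2
    let ?T = "{t :: 'i rtree. nverts t \<le> Suc n}"
    have "{f :: 'i forest. forest_deg f \<le> Suc n} \<subseteq> mset ` {xs. set xs \<subseteq> ?T \<and> length xs \<le> Suc n}"
    proof
      fix f :: "'i forest" assume f: "f \<in> {f. forest_deg f \<le> Suc n}"
      obtain xs where xs: "f = mset xs" by (metis ex_mset)
      have "set xs \<subseteq> ?T"
      proof
        fix t assume "t \<in> set xs"
        then show "t \<in> ?T" using nverts_le_forest_deg[of t f] f xs by auto
      qed
      moreover have "length xs \<le> Suc n" using size_le_forest_deg[of f] f xs by simp
      ultimately show "f \<in> mset ` {xs. set xs \<subseteq> ?T \<and> length xs \<le> Suc n}" using xs by blast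
    qed
    then show ?case by (rule finite_subset) (intro finite_imageI finite_lists_length_le trees)
  }
qed

definition trees :: "'i \<Rightarrow> nat \<Rightarrow> 'i rtree set" where
  "trees i n = {t. rlabel t = i \<and> nverts t = n}"

lemma finite_trees: "finite (trees (i::'i::finite) n)"
  by (rule finite_subset[OF _ finite_trees_le[of n]]) (auto simp: trees_def)

definition forests :: "nat \<Rightarrow> 'i forest set" where
  "forests n = {f. forest_deg f = n}"

lemma finite_forests: "finite (forests n :: 'i::finite forest set)"
  by (rule finite_subset[OF _ finite_forests_le[of n]]) (auto simp: forests_def)

section \<open>The coefficients of the solution\<close>

text \<open>The product of the factorials of the multiplicities. Thus
  \<open>mset_fact (rlabels f) / mset_fact f\<close> is the multinomial number of ways to distribute
  the trees of \<open>f\<close> over factors \<open>X j\<close> matching their roots.\<close>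

definition mset_fact :: "'a multiset \<Rightarrow> 'k::field_char_0" where
  "mset_fact m = (\<Prod>x\<in>set_mset m. fact (count m x))"

lemma mset_fact_empty [simp]: "mset_fact {#} = 1"
  by (simp add: mset_fact_def)

lemma mset_fact_nonzero [simp]: "mset_fact m \<noteq> 0"
  by (simp add: mset_fact_def)

lemma mset_fact_add_mset: "mset_fact (add_mset x m) = of_nat (Suc (count m x)) * (mset_fact m :: 'k::field_char_0)"
proof -
  have "(\<Prod>y\<in>set_mset m - {x}. fact (count (add_mset x m) y)) = (\<Prod>y\<in>set_mset m - {x}. fact (count m y) :: 'k)"
    by (rule prod.cong) auto
  moreover have "(\<Prod>y\<in>insert x (set_mset m). fact (count m y)) = (mset_fact m :: 'k)"
    unfolding mset_fact_def
    by (rule prod.mono_neutral_right) (auto simp: not_in_iff)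
  ultimately show ?thesis
    unfolding mset_fact_def
    by (simp add: prod.insert_remove del: of_nat_Suc)
qed

text \<open>The coefficient of a tree in the solution. The factor \<open>forest_coef F f\<close> is
  spelled out, since \<open>forest_coef\<close> is itself defined from
  \<open>tree_coef\<close>.\<close>

primrec tree_coef :: "('i \<Rightarrow> ('i, 'k::field_char_0) series) \<Rightarrow> 'i rtree \<Rightarrow> 'k" where
  "tree_coef F (Node i f) = F i (rlabels f) *
     (mset_fact (rlabels f) / mset_fact f * prod_mset (image_mset (tree_coef F) f))"

definition forest_coef :: "('i \<Rightarrow> ('i, 'k::field_char_0) series) \<Rightarrow> 'i forest \<Rightarrow> 'k" where
  "forest_coef F f = mset_fact (rlabels f) / mset_fact f * (\<Prod>t\<in>#f. tree_coef F t)"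

lemma tree_coef_Node: "tree_coef F (Node i f) = F i (rlabels f) * forest_coef F f"
  by (simp add: forest_coef_def)

lemma forest_coef_empty [simp]: "forest_coef F {#} = 1"
  by (simp add: forest_coef_def)

lemma forest_coef_nonzero: "(\<And>t. t \<in># f \<Longrightarrow> tree_coef F t \<noteq> 0) \<Longrightarrow> forest_coef F f \<noteq> 0"
  by (auto simp: forest_coef_def)

lemma forest_coef_add_mset:
  "of_nat (Suc (count f t)) * forest_coef F (add_mset t f) =
     of_nat (Suc (count (rlabels f) (rlabel t))) * tree_coef F t * forest_coef F f"
  by (simp add: forest_coef_def mset_fact_add_mset del: of_nat_Suc)

lemma forest_coef_remove:
  assumes "t \<in># f"
  shows "of_nat (count f t) * forest_coef F f =
     of_nat (count (rlabels f) (rlabel t)) * tree_coef F t * forest_coef F (f - {#t#})"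
proof -
  obtain g where "f = add_mset t g" using assms by (metis insert_DiffM)
  then show ?thesis using forest_coef_add_mset[of g t F] by simp
qed

lemma count_rlabels: "count (rlabels f) k = (\<Sum>t | t \<in># f \<and> rlabel t = k. count f t)"
  by (simp add: count_image_mset vimage_def Int_def conj_commute)

text \<open>A Pascal-type recursion: the distributions of the trees over the factors are classified
  by the tree that one chosen factor \<open>X k\<close> contributes. After multiplication by the
  number of roots \<open>k\<close>, each summand becomes \<open>count f t\<close> copies of the
  total.\<close>

lemma forest_coef_sum:
  assumes "k \<in># rlabels f"
  shows "(\<Sum>t | t \<in># f \<and> rlabel t = k. tree_coef F t * forest_coef F (f - {#t#})) = forest_coef F f"
proof -
  let ?c = "of_nat (count (rlabels f) k)"
  have "?c * (\<Sum>t | t \<in># f \<and> rlabel t = k. tree_coef F t * forest_coef F (f - {#t#})) =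
      (\<Sum>t | t \<in># f \<and> rlabel t = k. of_nat (count f t) * forest_coef F f)"
    unfolding sum_distrib_left by (rule sum.cong) (auto simp: forest_coef_remove mult.assoc)
  also have "\<dots> = ?c * forest_coef F f"
    by (simp only: count_rlabels of_nat_sum sum_distrib_right)
  finally show ?thesis using assms 
    by (simp only: mult_cancel_left of_nat_eq_0_iff) (simp only: not_in_iff[symmetric] simp_thms)
qed

definition solution :: "('i::finite \<Rightarrow> ('i, 'k::field_char_0) series) \<Rightarrow> 'i \<Rightarrow> ('i, 'k) ck_hat" where
  "solution F i = Abs_fps (\<lambda>n. \<Sum>t\<in>trees i n. Poly_Mapping.single {#t#} (tree_coef F t))"

lemma lookup_solution_tree:
  "lookup (solution F i $ n) {#t#} = (if t \<in> trees i n then tree_coef F t else 0)"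
  by (simp add: solution_def lookup_sum lookup_single when_def finite_trees)

lemma lookup_solution_other: "\<nexists>t. g = {#t#} \<Longrightarrow> lookup (solution F i $ n) g = 0"
  by (auto simp: solution_def lookup_sum lookup_single when_def intro!: sum.neutral)

lemma keys_solution: "Poly_Mapping.keys (solution F i $ n) \<subseteq> (\<lambda>t. {#t#}) ` trees i n"
proof
  fix g assume g: "g \<in> Poly_Mapping.keys (solution F i $ n)"
  then obtain t where "g = {#t#}" using lookup_solution_other by (metis in_keys_iff)
  then show "g \<in> (\<lambda>t. {#t#}) ` trees i n"
    using g by (auto simp: in_keys_iff lookup_solution_tree split: if_splits)
qed

text \<open>Induction on \<open>m\<close>: one factor with index \<open>k\<close> is split off, and
  the trees it can contribute are summed by \<open>forest_coef_sum\<close>.\<close>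

lemma lookup_prod_solution:
  "lookup ((\<Prod>j\<in>#m. solution F j) $ n) f =
     (if forest_deg f = n \<and> rlabels f = m then forest_coef F f else 0)"
proof (induction m arbitrary: n f)
  case empty
  show ?case by (auto simp: lookup_one when_def)
next
  case (add k m)
  let ?P = "\<Prod>j\<in>#m. solution F j"
  \<comment> \<open>This summand does not depend on the degree \<open>q\<close> of the split-off
    factor, so the sums over \<open>q\<close> and over the trees of size \<open>q\<close> merge into
    one.\<close>
  define h where "h t = (if t \<in># f \<and> forest_deg f = n \<and> rlabels f = add_mset k m
    then tree_coef F t * forest_coef F (f - {#t#}) else 0)" for t
  have h: "lookup (Poly_Mapping.single {#t#} (tree_coef F t) * ?P $ (n - q)) f = h t"
    if "t \<in> trees k q" "q \<le> n" for t q
  proof (cases "t \<in># f")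
    case True
    then obtain g where "f = add_mset t g" by (metis insert_DiffM)
    then show ?thesis using that by (auto simp: h_def lookup_single_mult add.IH trees_def)
  next
    case False
    then show ?thesis by (simp add: h_def lookup_single_mult)
  qed
  have "lookup ((\<Prod>j\<in>#add_mset k m. solution F j) $ n) f =
      (\<Sum>q=0..n. \<Sum>t\<in>trees k q.
        lookup (Poly_Mapping.single {#t#} (tree_coef F t) * ?P $ (n - q)) f)"
    by (simp add: fps_mult_nth solution_def sum_distrib_right lookup_sum)
  also have "\<dots> = (\<Sum>q=0..n. \<Sum>t\<in>trees k q. h t)"
    using h by (intro sum.cong) auto
  also have "\<dots> = (\<Sum>q=0..n. \<Sum>t\<in>{t \<in> {t. rlabel t = k \<and> nverts t \<le> n}. nverts t = q}. h t)"
    by (intro sum.cong) (auto simp: trees_def)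
  also have "\<dots> = (\<Sum>t | rlabel t = k \<and> nverts t \<le> n. h t)"
    by (rule sum.group) (auto intro: finite_subset[OF _ finite_trees_le[of n]])
  also have "\<dots> = (if forest_deg f = n \<and> rlabels f = add_mset k m then forest_coef F f else 0)"
  proof (cases "forest_deg f = n \<and> rlabels f = add_mset k m")
    case True
    then have "(\<Sum>t | rlabel t = k \<and> nverts t \<le> n. h t) =
        (\<Sum>t | t \<in># f \<and> rlabel t = k. tree_coef F t * forest_coef F (f - {#t#}))"
      using nverts_le_forest_deg
      by (intro sum.mono_neutral_cong_right)
        (auto simp: h_def intro: finite_subset[OF _ finite_trees_le[of n]])
    then show ?thesis using True forest_coef_sum[of k f F] by simp
  next
    case False
    then show ?thesis by (auto simp: h_def)
  qed
  finally show ?case .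
qed

lemma lookup_series_subst_solution:
  "lookup (series_subst s (solution F) $ n) f =
     (if forest_deg f = n then s (rlabels f) * forest_coef F f else 0)"
proof -
  let ?M = "{m. s m \<noteq> 0 \<and> (\<Prod>j\<in>#m. solution F j) $ n \<noteq> 0}"
  \<comment> \<open>Finiteness of the index set matters, as an infinite sum is 0 by default. Every
    monomial involved is the root multiset of a forest of degree \<open>n\<close>.\<close>
  have "?M \<subseteq> rlabels ` forests n"
  proof
    fix m assume "m \<in> ?M"
    then have "(\<Prod>j\<in>#m. solution F j) $ n \<noteq> 0" by simp
    then obtain f where "lookup ((\<Prod>j\<in>#m. solution F j) $ n) f \<noteq> 0"
      by (metis lookup_zero poly_mapping_eqI)
    then show "m \<in> rlabels ` forests n"
      by (auto simp: lookup_prod_solution forests_def split: if_splits)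
  qed
  then have fin: "finite ?M" by (rule finite_subset) (simp add: finite_forests)
  have "lookup (series_subst s (solution F) $ n) f =
      (\<Sum>m\<in>?M. s m * lookup ((\<Prod>j\<in>#m. solution F j) $ n) f)"
    by (simp add: series_subst_def lookup_sum lookup_scale)
  also have "\<dots> = (\<Sum>m\<in>?M. if m = rlabels f
      then s (rlabels f) * lookup ((\<Prod>j\<in>#rlabels f. solution F j) $ n) f else 0)"
    by (rule sum.cong) (auto simp: lookup_prod_solution)
  also have "\<dots> = s (rlabels f) * lookup ((\<Prod>j\<in>#rlabels f. solution F j) $ n) f"
    by (simp only: sum.delta[OF fin]) auto
  finally show ?thesis by (simp add: lookup_prod_solution)
qed

lemma solution_solves: "sdse_solves F (solution F)"
  unfolding sdse_solves_def
proof (intro conjI allI)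
  fix i
  show "in_completion (solution F i)"
    using keys_solution[of F i] by (force simp: in_completion_def homogeneous_def trees_def)
  show "solution F i = graft_hat i (series_subst (F i) (solution F))"
  proof (rule fps_ext, rule poly_mapping_eqI)
    fix n g
    show "lookup (solution F i $ n) g = lookup (graft_hat i (series_subst (F i) (solution F)) $ n) g"
    proof (cases "\<exists>t. g = {#t#}")
      case True
      then obtain i' f where g: "g = {#Node i' f#}" by (metis rtree.exhaust)
      show ?thesis
        by (cases n) (auto simp: g graft_hat_def lookup_solution_tree lookup_graft_tree trees_def
          lookup_series_subst_solution tree_coef_Node nverts_Node simp del: nverts.simps tree_coef.simps)
    next
      case False
      then show ?thesis by (simp add: graft_hat_def lookup_solution_other lookup_graft_other)
    qed
  qed
qed

lemma prod_mset_fps_cong: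
  assumes "\<And>j k. k \<le> n \<Longrightarrow> X j $ k = Y j $ k" "k \<le> n"
  shows "(\<Prod>j\<in>#m. X j) $ k = (\<Prod>j\<in>#m. Y j :: 'a::comm_semiring_1 fps) $ k"
  using assms(2)
  by (induction m arbitrary: k) (auto simp: fps_mult_nth assms(1) intro!: sum.cong)

text \<open>Grafting raises the degree by one, so the component of degree \<open>n\<close> is
  determined by those of smaller degree.\<close>

lemma sdse_solves_unique:
  assumes "sdse_solves F X" "sdse_solves F Y"
  shows "X = Y"
proof -
  have "X i $ n = Y i $ n" for i n
  proof (induction n arbitrary: i rule: less_induct)
    case (less n)
    have X: "X i = graft_hat i (series_subst (F i) X)" and Y: "Y i = graft_hat i (series_subst (F i) Y)"
      using assms by (auto simp: sdse_solves_def)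
    show ?case
    proof (cases n)
      case 0
      then show ?thesis by (subst X, subst Y) (simp add: graft_hat_def)
    next
      case (Suc n')
      have "(\<Prod>j\<in>#m. X j) $ n' = (\<Prod>j\<in>#m. Y j) $ n'" for m
        using less Suc by (intro prod_mset_fps_cong[of n']) auto
      then show ?thesis by (subst X, subst Y) (simp add: graft_hat_def series_subst_def Suc)
    qed
  qed
  then show ?thesis by (intro ext fps_ext)
qed

lemma sdse_solution_eq: "sdse_solution F = solution F"
  unfolding sdse_solution_def using solution_solves sdse_solves_unique by (intro the_equality) auto

section \<open>Hopf systems\<close>

lemma subalgebra_sdse_algebra: "hopf_sdse F \<Longrightarrow> subalgebra (sdse_algebra F)"
  by (simp add: hopf_sdse_def hopf_subalgebra_def)

text \<open>Proportionality to \<open>tree_coef\<close> on every set \<open>trees i n\<close>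
  defines a subalgebra, stable under products by \<open>lookup_mult_tree\<close>. It contains the
  generators, hence their hull.\<close>

lemma sdse_algebra_tree_part:
  fixes F :: "'i::finite \<Rightarrow> ('i, 'k::field_char_0) series"
  assumes "y \<in> sdse_algebra F"
  shows "\<exists>c. \<forall>t\<in>trees i n. lookup y {#t#} = c * tree_coef F t"
proof -
  let ?A = "{y :: ('i, 'k) ck. \<forall>i n. \<exists>c. \<forall>t\<in>trees i n. lookup y {#t#} = c * tree_coef F t}"
  have "subalgebra ?A"
    unfolding subalgebra_def
  proof (intro conjI ballI)
    show "ck_subspace ?A"
    proof (rule ck.subspaceI)
      show "0 \<in> ?A" by (auto intro: exI[of _ 0])
    next
      fix x y assume x: "x \<in> ?A" and y: "y \<in> ?A"
      show "x + y \<in> ?A"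
      proof (intro CollectI allI)
        fix i n
        obtain c where c: "\<forall>t\<in>trees i n. lookup x {#t#} = c * tree_coef F t" using x by blast
        obtain d where d: "\<forall>t\<in>trees i n. lookup y {#t#} = d * tree_coef F t" using y by blast
        show "\<exists>c. \<forall>t\<in>trees i n. lookup (x + y) {#t#} = c * tree_coef F t"
          using c d by (intro exI[of _ "c + d"]) (simp add: lookup_add algebra_simps)
      qed
    next
      fix a and x assume x: "x \<in> ?A"
      show "scale a x \<in> ?A"
      proof (intro CollectI allI)
        fix i n
        obtain c where c: "\<forall>t\<in>trees i n. lookup x {#t#} = c * tree_coef F t" using x by blast
        show "\<exists>c. \<forall>t\<in>trees i n. lookup (scale a x) {#t#} = c * tree_coef F t"
          using c by (intro exI[of _ "a * c"]) (simp add: lookup_scale)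
      qed
    qed
    show "1 \<in> ?A" by (auto simp: lookup_one intro: exI[of _ 0])
  next
    fix x y assume x: "x \<in> ?A" and y: "y \<in> ?A"
    show "x * y \<in> ?A"
    proof (intro CollectI allI)
      fix i n
      obtain c where c: "\<forall>t\<in>trees i n. lookup x {#t#} = c * tree_coef F t" using x by blast
      obtain d where d: "\<forall>t\<in>trees i n. lookup y {#t#} = d * tree_coef F t" using y by blast
      show "\<exists>c. \<forall>t\<in>trees i n. lookup (x * y) {#t#} = c * tree_coef F t"
        using c d by (intro exI[of _ "lookup x {#} * d + c * lookup y {#}"])
          (simp add: lookup_mult_tree algebra_simps)
    qed
  qed
  moreover have "{sdse_solution F i $ n | i n. True} \<subseteq> ?A"
  proof -
    have "\<exists>c. \<forall>t\<in>trees i' n'. lookup (solution F i $ n) {#t#} = c * tree_coef F t" for i n i' n'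
      by (intro exI[of _ "of_bool (i = i' \<and> n = n')"]) (auto simp: lookup_solution_tree trees_def)
    then show ?thesis by (auto simp: sdse_solution_eq)
  qed
  ultimately have "sdse_algebra F \<subseteq> ?A"
    unfolding sdse_algebra_def by (intro hull_minimal)
  then show ?thesis using assms by blast
qed

section \<open>Contraction of the left tensor factor with a forest\<close>

definition slice :: "'b \<Rightarrow> ('b \<times> 'c \<Rightarrow>\<^sub>0 'k::field) \<Rightarrow> ('c \<Rightarrow>\<^sub>0 'k)" where
  "slice u z = Poly_Mapping.map_key (Pair u) z"

lemma lookup_slice: "lookup (slice u z) v = lookup z (u, v)"
  by (simp add: slice_def map_key.rep_eq inj_on_def)

lemma lookup_tensor: "lookup (tensor x y) (u, v) = lookup x u * lookup y v"
proof -
  have y: "lookup (lin_ext (\<lambda>g. forest_el (f, g)) y) (u, v) = (if f = u then lookup y v else 0)" for f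
    by (subst lookup_lin_ext[of "insert v (Poly_Mapping.keys y)"])
      (auto simp: forest_el_def lookup_single when_def if_distrib cong: if_cong)
  show ?thesis
    unfolding tensor_def
    by (subst lookup_lin_ext[of "insert u (Poly_Mapping.keys x)"])
      (auto simp: y if_distrib cong: if_cong)
qed

text \<open>The slice of \<open>tensor x y\<close> is a scalar multiple of \<open>y\<close>, so
  slicing sends the span of the tensors over the algebra back into the algebra.\<close>

lemma slice_coprod_mem:
  assumes "hopf_sdse F" "x \<in> sdse_algebra F"
  shows "slice u (coprod x) \<in> sdse_algebra F"
proof -
  let ?A = "sdse_algebra F"
  have sub: "ck_subspace ?A"
    using subalgebra_sdse_algebra[OF assms(1)] by (simp add: subalgebra_def)
  have "ck_span {tensor x y | x y. x \<in> ?A \<and> y \<in> ?A} \<subseteq> {z. slice u z \<in> ?A}"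
  proof (rule ck.span_minimal)
    have "slice u (tensor x y) = scale (lookup x u) y" for x y :: "('a, 'b) ck"
      by (rule poly_mapping_eqI) (simp add: lookup_slice lookup_tensor lookup_scale)
    then show "{tensor x y | x y. x \<in> ?A \<and> y \<in> ?A} \<subseteq> {z. slice u z \<in> ?A}"
      using ck.subspace_scale[OF sub] by auto
    have "slice u 0 = (0 :: ('a, 'b) ck)"
      by (rule poly_mapping_eqI) (simp add: lookup_slice)
    moreover have "slice u (x + y) = slice u x + slice u y" for x y :: "('a, 'b) ck2"
      by (rule poly_mapping_eqI) (simp add: lookup_slice lookup_add)
    moreover have "slice u (scale c x) = scale c (slice u x)" for c and x :: "('a, 'b) ck2"
      by (rule poly_mapping_eqI) (simp add: lookup_slice lookup_scale)
    ultimately show "ck_subspace {z. slice u z \<in> ?A}"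
      using ck.subspace_0[OF sub] ck.subspace_add[OF sub] ck.subspace_scale[OF sub]
      by (intro ck.subspaceI) auto
  qed
  then show ?thesis
    using assms by (auto simp: hopf_sdse_def hopf_subalgebra_def)
qed

lemma lookup_coprod_solution:
  "lookup (coprod (solution F i $ n)) p = (\<Sum>t\<in>trees i n. tree_coef F t * lookup (coprod_tree t) p)"
proof -
  have "lookup (coprod (solution F i $ n)) p = (\<Sum>f\<in>(\<lambda>t. {#t#}) ` trees i n.
      lookup (solution F i $ n) f * lookup (\<Prod>t\<in>#f. coprod_tree t) p)"
    unfolding coprod_def by (rule lookup_lin_ext[OF _ keys_solution]) (simp add: finite_trees)
  also have "\<dots> = (\<Sum>t\<in>trees i n. tree_coef F t * lookup (coprod_tree t) p)"
    by (subst sum.reindex) (auto simp: inj_on_def lookup_solution_tree)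
  finally show ?thesis .
qed

text \<open>Slices of the coproduct stay in the algebra, where tree parts are rigid by
  \<open>sdse_algebra_tree_part\<close>. With \<open>u\<close> a single vertex, \<open>c\<close>
  becomes the scalar attached to \<open>i\<close>, \<open>n\<close> and that vertex.\<close>

lemma hopf_tree_identity:
  fixes F :: "'i::finite \<Rightarrow> ('i, 'k::field_char_0) series"
  assumes "hopf_sdse F"
  shows "\<exists>c. \<forall>s\<in>trees i n.
    (\<Sum>t\<in>trees i (Suc n). tree_coef F t * lookup (coprod_tree t) (u, {#s#})) = c * tree_coef F s"
proof -
  have "sdse_solution F i $ Suc n \<in> sdse_algebra F"
    unfolding sdse_algebra_def by (rule hull_inc) blast
  then have "slice u (coprod (solution F i $ Suc n)) \<in> sdse_algebra F"
    using slice_coprod_mem[OF assms] by (simp add: sdse_solution_eq)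
  from sdse_algebra_tree_part[OF this, of i n] show ?thesis
    by (simp add: lookup_slice lookup_coprod_solution)
qed

section \<open>Cutting off a leaf\<close>

text \<open>The contraction of the coproduct of a tree with a single vertex decorated by
  \<open>j\<close>: a sum over its leaves \<open>j\<close>, the empty forest being left if the tree
  is that leaf. The pairs \<open>(s, cut_leaf j s)\<close> keep a branch next to its recursive
  value.\<close>

primrec cut_leaf :: "'i \<Rightarrow> 'i rtree \<Rightarrow> ('i, 'k::field) ck" where
  "cut_leaf j (Node i f) =
     graft i (\<Sum>(s, d)\<in>#image_mset (\<lambda>s. (s, cut_leaf j s)) f. d * forest_el (f - {#s#})) +
     (if i = j \<and> f = {#} then 1 else 0)"

definition cut_leaf_forest :: "'i \<Rightarrow> 'i forest \<Rightarrow> ('i, 'k::field) ck" where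
  "cut_leaf_forest j f = (\<Sum>s\<in>#f. cut_leaf j s * forest_el (f - {#s#}))"

lemma cut_leaf_Node:
  "cut_leaf j (Node i f) = graft i (cut_leaf_forest j f) + (if i = j \<and> f = {#} then 1 else 0)"
  by (simp add: cut_leaf_forest_def multiset.map_comp o_def)

declare cut_leaf.simps [simp del]

section \<open>Marked plane trees and the forests they separate\<close>

text \<open>The root may be marked here too, and then the remaining trunk is detached as well. With
  this convention detached and kept forests are additive over lists of branches.\<close>

definition detached :: "('i \<times> bool) ptree \<Rightarrow> 'i forest" where
  "detached q = branches q + (if snd (plabel q) then {#trunk q#} else {#})"

definition kept :: "('i \<times> bool) ptree \<Rightarrow> 'i forest" where
  "kept q = (if snd (plabel q) then {#} else {#trunk q#})"

definition detached_list :: "('i \<times> bool) ptree list \<Rightarrow> 'i forest" where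
  "detached_list qs = (\<Sum>q\<leftarrow>qs. detached q)"

definition kept_list :: "('i \<times> bool) ptree list \<Rightarrow> 'i forest" where
  "kept_list qs = (\<Sum>q\<leftarrow>qs. kept q)"

lemma detached_list_simps [simp]:
  "detached_list [] = {#}" "detached_list (q # qs) = detached q + detached_list qs"
  "kept_list [] = {#}" "kept_list (q # qs) = kept q + kept_list qs"
  by (simp_all add: detached_list_def kept_list_def)

lemma branches_eq: "branches (PNode a qs) = detached_list qs"
  by (simp add: detached_list_def detached_def[abs_def])

lemma trunk_eq: "trunk (PNode a qs) = Node (fst a) (kept_list qs)"
proof -
  have "mset (map trunk (filter (\<lambda>q. \<not> snd (plabel q)) qs)) = kept_list qs"
    by (induction qs) (auto simp: kept_def)
  then show ?thesis by simp
qed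

declare branches.simps [simp del] trunk.simps [simp del]

lemma detached_PNode: "detached (PNode a qs) = detached_list qs + (if snd a then {#Node (fst a) (kept_list qs)#} else {#})"
  by (simp add: detached_def branches_eq trunk_eq)

lemma kept_PNode: "kept (PNode a qs) = (if snd a then {#} else {#Node (fst a) (kept_list qs)#})"
  by (simp add: kept_def trunk_eq)

definition unmarked :: "'i ptree \<Rightarrow> ('i \<times> bool) ptree" where
  "unmarked p = map_ptree (\<lambda>x. (x, False)) p"

text \<open>The path condition of \<open>cuts\<close> is not imposed: it is automatic for the
  markings that detach a single tree.\<close>

definition markings :: "'i ptree \<Rightarrow> ('i \<times> bool) ptree set" where
  "markings p = {q. map_ptree fst q = p}"

definition list_markings :: "'i ptree list \<Rightarrow> ('i \<times> bool) ptree list set" where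
  "list_markings ps = {qs. map (map_ptree fst) qs = ps}"

lemma unmarked_PNode: "unmarked (PNode i ps) = PNode (i, False) (map unmarked ps)"
  by (simp add: unmarked_def)

lemma markings_PNode:
  "markings (PNode i ps) = (\<lambda>(b, qs). PNode (i, b) qs) ` (UNIV \<times> list_markings ps)"
proof (intro set_eqI)
  fix q
  show "q \<in> markings (PNode i ps) \<longleftrightarrow> q \<in> (\<lambda>(b, qs). PNode (i, b) qs) ` (UNIV \<times> list_markings ps)"
    by (cases q) (auto simp: markings_def list_markings_def image_iff)
qed

lemma list_markings_Nil: "list_markings [] = {[]}"
  by (auto simp: list_markings_def)

lemma list_markings_Cons:
  "list_markings (p # ps) = (\<lambda>(q, qs). q # qs) ` (markings p \<times> list_markings ps)"
  by (auto simp: list_markings_def markings_def Cons_eq_map_conv image_iff map_eq_Cons_conv)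

lemma unmarked_in_markings: "unmarked p \<in> markings p"
  by (simp add: unmarked_def markings_def ptree.map_comp o_def ptree.map_ident)

lemma map_unmarked_in_list_markings: "map unmarked ps \<in> list_markings ps"
proof -
  have "map_ptree fst (unmarked p) = p" for p :: "'a ptree"
    using unmarked_in_markings[of p] by (simp add: markings_def)
  then show ?thesis by (simp add: list_markings_def o_def)
qed

lemma finite_list_markings_aux:
  "(\<And>p. p \<in> set ps \<Longrightarrow> finite (markings p)) \<Longrightarrow> finite (list_markings ps)"
  by (induction ps) (auto simp: list_markings_Nil list_markings_Cons)

lemma finite_markings: "finite (markings p)"
proof (induction p)
  case (PNode i ps)
  then have "finite (list_markings ps)" by (rule finite_list_markings_aux)
  then show ?case unfolding markings_PNode by (intro finite_imageI finite_cartesian_product) auto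
qed

lemma finite_list_markings: "finite (list_markings ps)"
  by (simp add: finite_list_markings_aux finite_markings)

lemma unmarked_values:
  "detached (unmarked p) = {#} \<and> kept (unmarked p) = {#shape p#}"
proof (induction p)
  case (PNode i ps)
  have "detached_list (map unmarked ps) = {#} \<and> kept_list (map unmarked ps) = mset (map shape ps)"
    using PNode.IH by (induction ps) auto
  then show ?case by (simp add: unmarked_PNode detached_PNode kept_PNode)
qed

lemma list_unmarked_values:
  "detached_list (map unmarked ps) = {#}" "kept_list (map unmarked ps) = mset (map shape ps)"
  by (induction ps) (auto simp: unmarked_values)

text \<open>Every marked vertex contributes a detached tree.\<close>

lemma detached_empty_imp: "detached q = {#} \<Longrightarrow> q = unmarked (map_ptree fst q)"
proof (induction q)
  case (PNode a qs)
  then have a: "\<not> snd a" and "detached_list qs = {#}" by (auto simp: detached_PNode split: if_splits)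
  from this(2) PNode.IH have "qs = map (\<lambda>q. unmarked (map_ptree fst q)) qs"
    by (induction qs) auto
  then show ?case using a by (cases a) (simp add: unmarked_PNode o_def)
qed

lemma detached_empty_iff: "q \<in> markings p \<Longrightarrow> detached q = {#} \<longleftrightarrow> q = unmarked p"
  using detached_empty_imp[of q] unmarked_values[of p] by (auto simp: markings_def)

lemma detached_list_empty_iff: "qs \<in> list_markings ps \<Longrightarrow> detached_list qs = {#} \<longleftrightarrow> qs = map unmarked ps"
  by (induction ps arbitrary: qs)
    (auto simp: list_markings_Nil list_markings_Cons detached_empty_iff)

definition plane_cut_leaf :: "'i \<Rightarrow> 'i ptree \<Rightarrow> ('i, 'k::field) ck" where
  "plane_cut_leaf j p =
     (\<Sum>q\<in>{q \<in> markings p. detached q = {#Node j {#}#}}. forest_el (kept q))"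

definition plane_cut_leaf_list :: "'i \<Rightarrow> 'i ptree list \<Rightarrow> ('i, 'k::field) ck" where
  "plane_cut_leaf_list j ps =
     (\<Sum>qs\<in>{qs \<in> list_markings ps. detached_list qs = {#Node j {#}#}}. forest_el (kept_list qs))"

lemma forest_el_add: "forest_el (f + g) = forest_el f * (forest_el g :: ('i, 'k::field) ck)"
  by (simp add: forest_el_def mult_single)

lemma plane_cut_leaf_list_Nil: "plane_cut_leaf_list j [] = 0"
  unfolding plane_cut_leaf_list_def
  by (rule sum.neutral) (auto simp: list_markings_Nil)

text \<open>A Leibniz rule: a one-element multiset is a sum in only two ways, so the leaf is cut
  either from the head or from the tail, and the other part carries no mark.\<close>

lemma plane_cut_leaf_list_Cons:
  "plane_cut_leaf_list j (p # ps) =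
     plane_cut_leaf j p * forest_el (mset (map shape ps)) +
     forest_el {#shape p#} * plane_cut_leaf_list j ps"
proof -
  let ?u = "{#Node j {#}#}"
  let ?A = "{q \<in> markings p. detached q = ?u}" and ?B = "{qs \<in> list_markings ps. detached_list qs = ?u}"
  have "{qs \<in> list_markings (p # ps). detached_list qs = ?u} =
      (\<lambda>q. q # map unmarked ps) ` ?A \<union> (\<lambda>qs. unmarked p # qs) ` ?B"
    by (auto simp: list_markings_Cons union_is_single detached_empty_iff detached_list_empty_iff
      unmarked_values list_unmarked_values unmarked_in_markings map_unmarked_in_list_markings image_iff)
  moreover have "(\<lambda>q. q # map unmarked ps) ` ?A \<inter> (\<lambda>qs. unmarked p # qs) ` ?B = {}"
    by (auto simp: list_unmarked_values)
  ultimately have "plane_cut_leaf_list j (p # ps) =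
      (\<Sum>qs\<in>(\<lambda>q. q # map unmarked ps) ` ?A. forest_el (kept_list qs)) +
      (\<Sum>qs\<in>(\<lambda>qs. unmarked p # qs) ` ?B. forest_el (kept_list qs))"
    unfolding plane_cut_leaf_list_def
    by (simp add: sum.union_disjoint finite_markings finite_list_markings)
  also have "\<dots> = (\<Sum>q\<in>?A. forest_el (kept q) * forest_el (mset (map shape ps))) +
      (\<Sum>qs\<in>?B. forest_el {#shape p#} * forest_el (kept_list qs))"
    by (subst (1 2) sum.reindex)
      (simp_all add: inj_on_def forest_el_add list_unmarked_values unmarked_values
        del: union_mset_add_mset_left)
  finally show ?thesis
    by (simp add: plane_cut_leaf_def plane_cut_leaf_list_def sum_distrib_left sum_distrib_right)
qed

lemma graft_0 [simp]: "graft i 0 = 0"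
  by (simp add: graft_def lin_ext_def)

lemma graft_add: "graft i (x + y) = graft i x + graft i y"
proof (rule poly_mapping_eqI)
  fix g
  show "lookup (graft i (x + y)) g = lookup (graft i x + graft i y) g"
  proof (cases "\<exists>t. g = {#t#}")
    case True
    then obtain i' f where "g = {#Node i' f#}" by (metis rtree.exhaust)
    then show ?thesis by (simp add: lookup_add lookup_graft_tree algebra_simps)
  qed (simp add: lookup_add lookup_graft_other)
qed

lemma graft_sum: "graft i (\<Sum>x\<in>A. h x) = (\<Sum>x\<in>A. graft i (h x))"
  by (induction A rule: infinite_finite_induct) (auto simp: graft_add)

lemma graft_forest_el: "graft i (forest_el f) = forest_el {#Node i f#}"
  by (simp add: graft_def lin_ext_def forest_el_def scale_def mult_single)

text \<open>A marked root already detaches one tree, so nothing below it is marked and the detached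
  tree is the whole tree. It is a single vertex only in the absence of branches.\<close>

lemma plane_cut_leaf_PNode:
  "plane_cut_leaf j (PNode i ps) =
     graft i (plane_cut_leaf_list j ps) + (if i = j \<and> ps = [] then 1 else 0)"
proof -
  let ?u = "{#Node j {#}#}"
  let ?B = "{qs \<in> list_markings ps. detached_list qs = ?u}"
  let ?C = "if i = j \<and> ps = [] then {PNode (i, True) []} else {}"
  have "detached_list qs + {#Node i (kept_list qs)#} = ?u \<longleftrightarrow> i = j \<and> ps = [] \<and> qs = []"
    if "qs \<in> list_markings ps" for qs
  proof -
    have "detached_list qs + {#Node i (kept_list qs)#} = ?u \<longleftrightarrow>
        detached_list qs = {#} \<and> i = j \<and> kept_list qs = {#}"
      by (auto simp: union_is_single)
    also have "\<dots> \<longleftrightarrow> i = j \<and> ps = [] \<and> qs = []"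
      using detached_list_empty_iff[OF that] that by (auto simp: list_unmarked_values list_markings_Nil)
    finally show ?thesis .
  qed
  then have "{q \<in> markings (PNode i ps). detached q = ?u} = PNode (i, False) ` ?B \<union> ?C"
    by (auto simp: markings_PNode detached_PNode list_markings_Nil split: if_splits)
  moreover have "PNode (i, False) ` ?B \<inter> ?C = {}" by auto
  ultimately have "plane_cut_leaf j (PNode i ps) =
      (\<Sum>q\<in>PNode (i, False) ` ?B. forest_el (kept q)) + (\<Sum>q\<in>?C. forest_el (kept q))"
    unfolding plane_cut_leaf_def
    by (simp add: sum.union_disjoint finite_list_markings)
  also have "(\<Sum>q\<in>PNode (i, False) ` ?B. forest_el (kept q)) = graft i (plane_cut_leaf_list j ps)"
    by (subst sum.reindex)
      (auto simp: inj_on_def kept_PNode plane_cut_leaf_list_def graft_sum graft_forest_el)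
  also have "(\<Sum>q\<in>?C. forest_el (kept q)) = (if i = j \<and> ps = [] then 1 else 0)"
    by (simp add: kept_PNode forest_el_def)
  finally show ?thesis .
qed

lemma cut_leaf_forest_add_mset:
  "cut_leaf_forest j (add_mset s f) =
     cut_leaf j s * forest_el f + forest_el {#s#} * cut_leaf_forest j f"
proof -
  have "(\<Sum>s'\<in>#f. cut_leaf j s' * forest_el (add_mset s f - {#s'#})) =
      (\<Sum>s'\<in>#f. forest_el {#s#} * (cut_leaf j s' * forest_el (f - {#s'#})))"
  proof (intro arg_cong[where f = sum_mset] image_mset_cong)
    fix s' assume "s' \<in># f"
    then have "add_mset s f - {#s'#} = {#s#} + (f - {#s'#})" by simp
    then show "cut_leaf j s' * forest_el (add_mset s f - {#s'#}) =
        forest_el {#s#} * (cut_leaf j s' * forest_el (f - {#s'#}))"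
      by (simp only: forest_el_add ac_simps)
  qed
  then show ?thesis by (simp add: cut_leaf_forest_def sum_mset_distrib_left)
qed

text \<open>Both sides obey the same recursion, a Leibniz rule over the branches followed by
  grafting. In particular the plane representative does not matter.\<close>

lemma plane_cut_leaf_eq: "plane_cut_leaf j p = (cut_leaf j (shape p) :: ('a, 'b::field) ck)"
proof (induction p)
  case (PNode i ps)
  then have "plane_cut_leaf_list j ps = (cut_leaf_forest j (mset (map shape ps)) :: ('a, 'b) ck)"
  proof (induction ps)
    case Nil
    then show ?case by (simp add: plane_cut_leaf_list_Nil cut_leaf_forest_def)
  next
    case (Cons p ps)
    then show ?case by (simp add: plane_cut_leaf_list_Cons cut_leaf_forest_add_mset)
  qed
  then show ?case by (simp add: plane_cut_leaf_PNode cut_leaf_Node)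
qed

lemma ex_shape: "\<exists>p. shape p = t"
proof (induction t)
  case (Node i f)
  obtain ts where ts: "mset ts = f" by (metis ex_mset)
  have "\<forall>t\<in>set ts. \<exists>p. shape p = t" using Node ts by auto
  then obtain h where "\<forall>t\<in>set ts. shape (h t) = t" by metis
  then have "map shape (map h ts) = ts" by (simp add: map_idI)
  then have "shape (PNode i (map h ts)) = Node i f" using ts by simp
  then show ?case by blast
qed

text \<open>Each marked vertex on a path accounts for a detached tree of its own, so detaching at
  most one tree forces the path condition of \<open>cuts\<close>.\<close>

lemma path_marks_le:
  "bs \<in> path_marks q \<Longrightarrow> length (filter id bs) \<le> size (detached q)"
proof (induction q arbitrary: bs)
  case (PNode a qs)
  show ?case
  proof (cases "qs = []")
    case True
    then show ?thesis using PNode.prems by (auto simp: detached_PNode)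
  next
    case False
    then obtain q cs where q: "q \<in> set qs" "cs \<in> path_marks q" "bs = snd a # cs"
      using PNode.prems by auto
    have "size (detached q) \<le> size (detached_list qs)"
      using q(1) by (induction qs) auto
    then show ?thesis using PNode.IH[OF q(1,2)] q(3) by (auto simp: detached_PNode)
  qed
qed

lemma unmarked_if_not_marked_edges: "\<not> marked_edges q \<Longrightarrow> detached q = {#}"
proof (induction q)
  case (PNode a qs)
  then have "\<not> snd a" and "\<And>q. q \<in> set qs \<Longrightarrow> detached q = {#}"
    by (auto simp: marked_edges_def)
  moreover from this(2) have "detached_list qs = {#}" by (induction qs) auto
  ultimately show ?case by (simp add: detached_PNode)
qed

text \<open>The two primitive terms have an empty factor and do not contribute, so only cuts
  detaching exactly the leaf remain.\<close>

lemma lookup_coprod_tree: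
  "lookup (coprod_tree t) ({#Node j {#}#}, {#s#}) = (lookup (cut_leaf j t) {#s#} :: 'k::field)"
proof -
  let ?u = "{#Node j {#}#}"
  define p where "p = (SOME p. shape p = t)"
  have p: "shape p = t" unfolding p_def by (rule someI_ex) (rule ex_shape)
  have "finite (cuts p)"
    by (rule finite_subset[OF _ finite_markings[of p]]) (auto simp: cuts_def markings_def)
  have "lookup (coprod_tree t) (?u, {#s#}) =
      (\<Sum>q\<in>cuts p. if branches q = ?u \<and> trunk q = s then 1 else 0)"
    by (auto simp: coprod_tree_def p_def lookup_add lookup_sum forest_el_def lookup_single when_def
      intro!: sum.cong)
  also have "\<dots> = (\<Sum>q\<in>{q \<in> cuts p. branches q = ?u \<and> trunk q = s}. 1)"
    using \<open>finite (cuts p)\<close> by (intro sum.mono_neutral_cong_right) auto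
  also have "{q \<in> cuts p. branches q = ?u \<and> trunk q = s} =
      {q \<in> markings p. detached q = ?u \<and> kept q = {#s#}}"
  proof -
    \<comment> \<open>A marking that detaches one tree has a marked edge and at most one mark on
      each path.\<close>
    have "q \<in> cuts p" if "q \<in> markings p" "detached q = ?u" "\<not> snd (plabel q)" for q
      using path_marks_le[of _ q] unmarked_if_not_marked_edges[of q] that
      by (fastforce simp: cuts_def markings_def)
    then show ?thesis
      by (auto simp: cuts_def markings_def detached_def kept_def split: if_splits)
  qed
  also have "(\<Sum>q\<in>\<dots>. 1) =
      (\<Sum>q\<in>{q \<in> markings p. detached q = ?u}. if kept q = {#s#} then 1 else (0::'k))"
    by (intro sum.mono_neutral_cong_left) (auto simp: finite_markings)
  also have "\<dots> = lookup (plane_cut_leaf j p) {#s#}"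
    by (simp add: plane_cut_leaf_def lookup_sum forest_el_def lookup_single when_def)
  finally show ?thesis by (simp add: plane_cut_leaf_eq p)
qed

section \<open>Support and degree after cutting a leaf\<close>

lemma lookup_sum_mset: "lookup (\<Sum>\<^sub># M) b = (\<Sum>x\<in>#M. lookup x b)"
  by (induction M) (auto simp: lookup_add)

lemma lookup_cut_leaf_empty: "lookup (cut_leaf j s) {#} = of_bool (s = Node j {#})"
  by (cases s) (auto simp: cut_leaf_Node lookup_add lookup_graft_other)

lemma lookup_cut_leaf_tree:
  "lookup (cut_leaf j (Node i f)) {#Node i' g#} = of_bool (i = i') * lookup (cut_leaf_forest j f) g"
  by (auto simp: cut_leaf_Node lookup_add lookup_graft_tree lookup_one when_def)

lemma lookup_cut_leaf_other: "g \<noteq> {#} \<Longrightarrow> \<nexists>t. g = {#t#} \<Longrightarrow> lookup (cut_leaf j s) g = 0"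
  by (cases s) (auto simp: cut_leaf_Node lookup_add lookup_graft_other lookup_one when_def)

lemma lookup_mult_forest_el:
  fixes x :: "('i, 'k::field) ck"
  shows "lookup (x * forest_el g) f = (if g \<subseteq># f then lookup x (f - g) else 0)"
  using lookup_single_mult[of g 1 x f] by (simp add: forest_el_def mult.commute)

text \<open>\<open>cut_leaf j s\<close> is supported on the empty forest and on single trees: either
  \<open>s\<close> is the leaf and disappears, or it shrinks to some tree \<open>s'\<close> of
  \<open>f\<close>.\<close>

lemma lookup_cut_leaf_mult:
  "lookup (cut_leaf j s * forest_el g) f = of_bool (g = f \<and> s = Node j {#}) +
     (\<Sum>s'\<in>set_mset f. of_bool (g = f - {#s'#}) * lookup (cut_leaf j s) {#s'#})"
proof (cases "g \<subseteq># f")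
  case True
  then obtain h where f: "f = g + h" by (metis subset_mset.less_eqE)
  have eq: "g = f - {#s'#} \<longleftrightarrow> h = {#s'#}" if "s' \<in># f" for s'
  proof -
    have "g = f - {#s'#} \<longleftrightarrow> add_mset s' g = f"
      using that by (metis add_mset_remove_trivial insert_DiffM)
    then show ?thesis by (auto simp: f)
  qed
  have sum: "(\<Sum>s'\<in>set_mset f. of_bool (g = f - {#s'#}) * lookup (cut_leaf j s) {#s'#}) =
      (\<Sum>s'\<in>set_mset f. if h = {#s'#} then lookup (cut_leaf j s) h else 0)"
    by (rule sum.cong) (auto simp: eq)
  show ?thesis
  proof (cases "\<exists>s0. h = {#s0#}")
    case True
    then obtain s0 where h: "h = {#s0#}" by blast
    then show ?thesis unfolding lookup_mult_forest_el sum by (simp add: f)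
  next
    case False
    then show ?thesis
      unfolding lookup_mult_forest_el sum
      by (cases "h = {#}") (auto simp: f lookup_cut_leaf_empty lookup_cut_leaf_other)
  qed
next
  case False
  then have "g \<noteq> f" "g \<noteq> f - {#s'#}" for s' by auto
  then show ?thesis unfolding lookup_mult_forest_el using False by simp
qed

lemma cut_leaf_deg: "lookup (cut_leaf j s) g \<noteq> (0 :: 'k::field) \<Longrightarrow> nverts s = Suc (forest_deg g)"
proof (induction s arbitrary: g)
  case (Node i f)
  consider "g = {#}" | i' g' where "g = {#Node i' g'#}" | "g \<noteq> {#}" "\<nexists>t. g = {#t#}"
    by (metis rtree.exhaust)
  then show ?case
  proof cases
    case 1
    then show ?thesis using Node.prems by (auto simp: lookup_cut_leaf_empty split: if_splits)
  next
    case (2 i' g')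
    then have "lookup (cut_leaf_forest j f) g' \<noteq> (0 :: 'k)"
      using Node.prems by (simp only: lookup_cut_leaf_tree) auto
    then have "(\<Sum>s\<in>#f. lookup (cut_leaf j s * forest_el (f - {#s#})) g') \<noteq> (0 :: 'k)"
      by (simp add: cut_leaf_forest_def lookup_sum_mset multiset.map_comp o_def)
    then obtain s where s: "s \<in># f" "lookup (cut_leaf j s * forest_el (f - {#s#})) g' \<noteq> (0 :: 'k)"
      by (metis (mono_tags, lifting) image_iff set_image_mset sum_mset.neutral)
    then have sub: "f - {#s#} \<subseteq># g'" and nz: "lookup (cut_leaf j s) (g' - (f - {#s#})) \<noteq> (0 :: 'k)"
      by (auto simp: lookup_mult_forest_el split: if_splits)
    obtain h where h: "g' = (f - {#s#}) + h" using sub by (metis subset_mset.less_eqE)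
    obtain f' where f': "f = add_mset s f'" using s(1) by (metis insert_DiffM)
    have "nverts s = Suc (forest_deg h)" using Node.IH[OF s(1) nz] by (simp add: h)
    then show ?thesis using 2 h f' by (simp add: nverts_Node del: nverts.simps)
  next
    case 3
    then show ?thesis using Node.prems by (simp add: lookup_cut_leaf_other)
  qed
qed

lemma cut_leaf_tree_deg:
  assumes "lookup (cut_leaf j s) {#s'#} \<noteq> 0"
  shows "s \<in> trees (rlabel s') (Suc (nverts s'))"
proof -
  have "rlabel s = rlabel s'"
    using assms by (cases s; cases s') (auto simp: lookup_cut_leaf_tree)
  then show ?thesis using cut_leaf_deg[OF assms] by (simp add: trees_def)
qed

lemma sum_mset_count:
  "(\<Sum>x\<in>#M. h x) = (\<Sum>x\<in>set_mset M. of_nat (count M x) * (h x :: 'k::comm_semiring_1))"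
proof (induction M)
  case (add x M)
  have "(\<Sum>y\<in>set_mset (add_mset x M). of_nat (count (add_mset x M) y) * h y) =
      (\<Sum>y\<in>insert x (set_mset M). of_nat (count M y) * h y + (if y = x then h x else 0))"
    by (rule sum.cong) (auto simp: algebra_simps)
  also have "\<dots> = (\<Sum>y\<in>insert x (set_mset M). of_nat (count M y) * h y) + h x"
    by (simp add: sum.distrib)
  also have "(\<Sum>y\<in>insert x (set_mset M). of_nat (count M y) * h y) =
      (\<Sum>y\<in>set_mset M. of_nat (count M y) * h y)"
    by (rule sum.mono_neutral_right) (auto simp: not_in_iff)
  finally show ?case using add.IH by (simp add: add.commute)
qed simp

lemma lookup_cut_leaf_forest:
  "lookup (cut_leaf_forest j f) g =
     (\<Sum>s\<in>set_mset f. of_nat (count f s) * lookup (cut_leaf j s * forest_el (f - {#s#})) g)"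
  unfolding cut_leaf_forest_def lookup_sum_mset by (simp add: multiset.map_comp o_def flip: sum_mset_count)

text \<open>With \<open>g\<close> fixed, the forest \<open>f\<close> is recovered from the removed
  tree \<open>s\<close>, so the double sum becomes a sum over the tree added to
  \<open>g\<close>.\<close>

lemma sum_forests_remove:
  fixes h :: "'i::finite forest \<Rightarrow> 'i rtree \<Rightarrow> 'k::comm_semiring_1"
  shows "(\<Sum>f\<in>forests n. \<Sum>s\<in>set_mset f. of_bool (f - {#s#} = g) * h f s) =
     (\<Sum>s | nverts s + forest_deg g = n. h (add_mset s g) s)"
proof -
  let ?S = "SIGMA f:(forests n :: 'i forest set). set_mset f"
  have fin: "finite ?S" by (intro finite_SigmaI finite_forests) simp
  have "(\<Sum>f\<in>forests n. \<Sum>s\<in>set_mset f. of_bool (f - {#s#} = g) * h f s) =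
      (\<Sum>(f, s)\<in>?S. of_bool (f - {#s#} = g) * h f s)"
    by (rule sum.Sigma) (auto simp: finite_forests)
  also have "\<dots> = (\<Sum>(f, s)\<in>{(f, s) \<in> ?S. f - {#s#} = g}. h f s)"
    by (rule sum.mono_neutral_cong_right) (use fin in \<open>auto split: if_splits simp: of_bool_def\<close>)
  also have "\<dots> = (\<Sum>s | nverts s + forest_deg g = n. h (add_mset s g) s)"
    by (rule sum.reindex_bij_witness[of _ "\<lambda>s. (add_mset s g, s)" snd])
      (auto simp: forests_def forest_deg_remove)
  finally show ?thesis .
qed

lemma trees_Suc: "trees i (Suc n) = Node i ` forests n"
proof (intro set_eqI)
  fix t
  show "t \<in> trees i (Suc n) \<longleftrightarrow> t \<in> Node i ` forests n"
    by (cases t) (auto simp: trees_def forests_def nverts_Node simp del: nverts.simps)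
qed

text \<open>Double counting of the trees \<open>Node i g\<close> from which cutting a leaf
  \<open>j\<close> yields \<open>Node i f\<close>: the leaf sat on the root, or a branch
  \<open>s'\<close> of \<open>f\<close> came from a larger branch. The hypothesis \<open>lam\<close>
  evaluates the total at \<open>Node i f\<close> and the second case at \<open>s'\<close>; the
  nonzero factor \<open>forest_coef F f\<close> cancels.\<close>

lemma leaf_identity:
  fixes F :: "'i::finite \<Rightarrow> ('i, 'k::field_char_0) series"
  assumes F0: "\<And>i. F i {#} = 1"
    and lam: "\<And>i n s. s \<in> trees i n \<Longrightarrow>
      (\<Sum>t\<in>trees i (Suc n). tree_coef F t * lookup (cut_leaf j t) {#s#}) = lam i n * tree_coef F s"
    and nz: "\<And>t. t \<in># f \<Longrightarrow> tree_coef F t \<noteq> 0"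
  shows "lam i (Suc (forest_deg f)) * F i (rlabels f) =
    of_nat (Suc (count (rlabels f) j)) * F i (add_mset j (rlabels f)) +
    F i (rlabels f) * (\<Sum>t\<in>#f. lam (rlabel t) (nverts t))"
proof -
  let ?n = "forest_deg f" and ?m = "rlabels f"
  \<comment> \<open>The coefficient of \<open>Node i g\<close> weighted by the multiplicity of the
    branch \<open>s\<close>, the shape to which \<open>forest_coef_add_mset\<close> applies.\<close>
  define W where "W g s = F i (rlabels g) * (of_nat (count g s) * forest_coef F g)" for g s
  have W: "W (add_mset s g) s = F i (add_mset (rlabel s) (rlabels g)) *
      (of_nat (Suc (count (rlabels g) (rlabel s))) * tree_coef F s * forest_coef F g)" for g s
    using forest_coef_add_mset[of g s F] by (simp add: W_def del: of_nat_Suc)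
  define L where "L s s' = (lookup (cut_leaf j s) {#s'#} :: 'k)" for s s'
  have "lam i (Suc ?n) * tree_coef F (Node i f) =
      (\<Sum>t\<in>trees i (Suc (Suc ?n)). tree_coef F t * lookup (cut_leaf j t) {#Node i f#})"
    by (rule lam[symmetric]) (simp add: trees_def nverts_Node del: nverts.simps)
  also have "\<dots> = (\<Sum>g\<in>forests (Suc ?n). F i (rlabels g) * forest_coef F g * lookup (cut_leaf_forest j g) f)"
    unfolding trees_Suc[of i "Suc ?n"]
    by (subst sum.reindex) (auto simp: inj_on_def tree_coef_Node lookup_cut_leaf_tree simp del: tree_coef.simps)
  also have "\<dots> = (\<Sum>g\<in>forests (Suc ?n). \<Sum>s\<in>set_mset g.
      of_bool (g - {#s#} = f) * (W g s * of_bool (s = Node j {#})) +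
      (\<Sum>s'\<in>set_mset f. of_bool (g - {#s#} = f - {#s'#}) * (W g s * L s s')))"
  proof (rule sum.cong)
    fix g
    have "F i (rlabels g) * forest_coef F g * lookup (cut_leaf_forest j g) f =
        (\<Sum>s\<in>set_mset g. W g s * lookup (cut_leaf j s * forest_el (g - {#s#})) f)"
      by (simp add: lookup_cut_leaf_forest W_def sum_distrib_left ac_simps)
    also have "\<dots> = (\<Sum>s\<in>set_mset g.
      of_bool (g - {#s#} = f) * (W g s * of_bool (s = Node j {#})) +
      (\<Sum>s'\<in>set_mset f. of_bool (g - {#s#} = f - {#s'#}) * (W g s * L s s')))"
      unfolding lookup_cut_leaf_mult L_def distrib_left sum_distrib_left of_bool_conj
      by (simp only: ac_simps)
    finally show "F i (rlabels g) * forest_coef F g * lookup (cut_leaf_forest j g) f =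
      (\<Sum>s\<in>set_mset g.
      of_bool (g - {#s#} = f) * (W g s * of_bool (s = Node j {#})) +
      (\<Sum>s'\<in>set_mset f. of_bool (g - {#s#} = f - {#s'#}) * (W g s * L s s')))" .
  qed simp
  also have "\<dots> = (\<Sum>g\<in>forests (Suc ?n). \<Sum>s\<in>set_mset g.
      of_bool (g - {#s#} = f) * (W g s * of_bool (s = Node j {#}))) +
      (\<Sum>s'\<in>set_mset f. \<Sum>g\<in>forests (Suc ?n). \<Sum>s\<in>set_mset g.
        of_bool (g - {#s#} = f - {#s'#}) * (W g s * L s s'))"
  proof -
    have "(\<Sum>g\<in>forests (Suc ?n). \<Sum>s\<in>set_mset g. \<Sum>s'\<in>set_mset f. h g s s') =
        (\<Sum>s'\<in>set_mset f. \<Sum>g\<in>forests (Suc ?n). \<Sum>s\<in>set_mset g. h g s s')"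
      for h :: "'i forest \<Rightarrow> 'i rtree \<Rightarrow> 'i rtree \<Rightarrow> 'k"
      by (subst sum.swap, subst (2) sum.swap, rule refl)
    then show ?thesis by (simp only: sum.distrib)
  qed
  \<comment> \<open>The leaf on the root: \<open>s\<close> has one vertex, and its coefficient is 1
    by \<open>F0\<close>.\<close>
  also have "(\<Sum>g\<in>forests (Suc ?n). \<Sum>s\<in>set_mset g.
      of_bool (g - {#s#} = f) * (W g s * of_bool (s = Node j {#}))) =
      of_nat (Suc (count ?m j)) * F i (add_mset j ?m) * forest_coef F f"
  proof -
    have "{s :: 'i rtree. nverts s + ?n = Suc ?n} = {s. nverts s = 1}" by auto
    moreover have "finite {s :: 'i rtree. nverts s = 1}"
      by (rule finite_subset[OF _ finite_trees_le[of 1]]) auto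
    ultimately show ?thesis
      unfolding sum_forests_remove W
      by (simp add: of_bool_def F0 ac_simps if_distrib sum.delta del: of_nat_Suc cong: if_cong)
  qed
  also have "(\<Sum>s'\<in>set_mset f. \<Sum>g\<in>forests (Suc ?n). \<Sum>s\<in>set_mset g.
        of_bool (g - {#s#} = f - {#s'#}) * (W g s * L s s')) =
      (\<Sum>s'\<in>set_mset f. F i ?m * forest_coef F f * (of_nat (count f s') * lam (rlabel s') (nverts s')))"
  proof (rule sum.cong)
    fix s' assume s': "s' \<in> set_mset f"
    let ?k = "rlabel s'"
    obtain g where g: "f = add_mset s' g" using s' by (metis insert_DiffM)
    have m: "?m = add_mset ?k (rlabels g)" by (simp add: g)
    have "(\<Sum>g\<in>forests (Suc ?n). \<Sum>s\<in>set_mset g.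
        of_bool (g - {#s#} = f - {#s'#}) * (W g s * L s s')) =
        (\<Sum>s | nverts s + forest_deg g = Suc ?n. W (add_mset s g) s * L s s')"
      unfolding sum_forests_remove by (simp add: g)
    \<comment> \<open>Only a tree with the root of \<open>s'\<close> and one more vertex can shrink
      to \<open>s'\<close>.\<close>
    also have "\<dots> = (\<Sum>s\<in>trees ?k (Suc (nverts s')). W (add_mset s g) s * L s s')"
    proof (rule sum.mono_neutral_right)
      show "finite {s :: 'i rtree. nverts s + forest_deg g = Suc ?n}"
        by (rule finite_subset[OF _ finite_trees_le[of "Suc ?n"]]) auto
      show "trees ?k (Suc (nverts s')) \<subseteq> {s. nverts s + forest_deg g = Suc ?n}"
        by (auto simp: trees_def g)
      show "\<forall>s\<in>{s. nverts s + forest_deg g = Suc ?n} - trees ?k (Suc (nverts s')).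
          W (add_mset s g) s * L s s' = 0"
        using cut_leaf_tree_deg[of j _ s'] by (auto simp: L_def)
    qed
    also have "\<dots> = (\<Sum>s\<in>trees ?k (Suc (nverts s')). F i ?m * (of_nat (Suc (count (rlabels g) ?k)) *
        forest_coef F g) * (tree_coef F s * L s s'))"
      by (rule sum.cong) (auto simp: W m trees_def ac_simps)
    also have "\<dots> = F i ?m * (of_nat (Suc (count (rlabels g) ?k)) * forest_coef F g) *
        (lam ?k (nverts s') * tree_coef F s')"
      unfolding sum_distrib_left[symmetric] L_def by (subst lam) (auto simp: trees_def)
    also have "\<dots> = F i ?m * lam ?k (nverts s') *
        (of_nat (Suc (count (rlabels g) ?k)) * tree_coef F s' * forest_coef F g)"
      by (simp only: ac_simps)
    also have "\<dots> = F i ?m * forest_coef F f * (of_nat (count f s') * lam ?k (nverts s'))"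
      unfolding forest_coef_add_mset[symmetric] by (simp add: g ac_simps del: of_nat_Suc)
    finally show "(\<Sum>g\<in>forests (Suc ?n). \<Sum>s\<in>set_mset g.
        of_bool (g - {#s#} = f - {#s'#}) * (W g s * L s s')) =
        F i ?m * forest_coef F f * (of_nat (count f s') * lam ?k (nverts s'))" .
  qed simp
  also have "\<dots> = F i ?m * forest_coef F f * (\<Sum>t\<in>#f. lam (rlabel t) (nverts t))"
    by (simp only: sum_mset_count sum_distrib_left)
  finally have "forest_coef F f * (lam i (Suc ?n) * F i ?m) =
      forest_coef F f * (of_nat (Suc (count ?m j)) * F i (add_mset j ?m) +
        F i ?m * (\<Sum>t\<in>#f. lam (rlabel t) (nverts t)))"
    by (simp add: tree_coef_Node algebra_simps del: of_nat_Suc tree_coef.simps)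
  then show ?thesis using forest_coef_nonzero[OF nz] by simp
qed

section \<open>Systems of leaf-grafting identities\<close>

text \<open>The identities for roots with at most two branches, with heredity of zeros. Branches
  enter only through their roots and sizes, since trees of every positive size with nonzero
  coefficient will be available.\<close>

locale leaf_system =
  fixes F :: "'i::finite \<Rightarrow> ('i, 'k::field_char_0) series"
    and lam :: "'i \<Rightarrow> 'i \<Rightarrow> nat \<Rightarrow> 'k"
  assumes F0: "F i {#} = 1"
    and hereditary: "F i m = 0 \<Longrightarrow> F i (add_mset j m) = 0"
    and lam1: "lam i j 1 = F i {#j#}"
    and lam_one: "n > 0 \<Longrightarrow> lam i j (Suc n) * F i {#k#} =
      of_nat (Suc (count {#k#} j)) * F i {#j, k#} + F i {#k#} * lam k j n"
    and lam_two: "a > 0 \<Longrightarrow> b > 0 \<Longrightarrow> lam i j (Suc (a + b)) * F i {#v, w#} =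
      of_nat (Suc (count {#v, w#} j)) * F i {#j, v, w#} + F i {#v, w#} * (lam v j a + lam w j b)"
begin

lemma zero_superset: "F i m = 0 \<Longrightarrow> m \<subseteq># m' \<Longrightarrow> F i m' = 0"
proof (induction m' arbitrary: m)
  case (add x m')
  show ?case
  proof (cases "m \<subseteq># m'")
    case True
    then show ?thesis using add hereditary by blast
  next
    case False
    define d where "d = add_mset x m' - m"
    have d: "add_mset x m' = m + d" using add.prems by (simp add: d_def)
    have "F i (m + d) = 0" for d
      by (induction d) (auto simp: add.prems hereditary)
    then show ?thesis by (simp add: d)
  qed
qed simp

text \<open>Zeros propagate to larger monomials, so a variable that occurs at all already occurs
  linearly.\<close>

lemma descendants_iff: "j \<in> descendants F i \<longleftrightarrow> F i {#j#} \<noteq> 0"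
proof -
  have "F i (add_mset j m) = 0" if "F i {#j#} = 0" for m
    using zero_superset[OF that] by simp
  moreover have "series_deriv j (F i) {#} \<noteq> 0" if "F i {#j#} \<noteq> 0"
    using that by (simp add: series_deriv_def)
  ultimately show ?thesis
    by (auto simp: descendants_def sdse_edges_def series_deriv_def fun_eq_iff simp del: of_nat_Suc)
qed

lemma edge_iff: "(i, j) \<in> sdse_edges F \<longleftrightarrow> F i {#j#} \<noteq> 0"
  using descendants_iff[of j i] by (simp add: descendants_def)

section \<open>Eventually periodic sequences and their phases\<close>

text \<open>The phase \<open>c\<close> matters modulo \<open>N\<close> and will be the class of
  \<open>x\<close>. The constant \<open>d\<close> and the threshold are left free because they
  change along edges.\<close>

definition eventually_periodic :: "nat \<Rightarrow> 'k \<Rightarrow> 'i \<Rightarrow> 'i \<Rightarrow> nat \<Rightarrow> bool" where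
  "eventually_periodic N e u x c \<longleftrightarrow>
     (\<exists>d n0. \<forall>n\<ge>n0. lam x u n = d + e * of_bool (N dvd n + c))"

text \<open>\<open>lam_one\<close> shifts the index by one and adds a quantity \<open>h\<close>
  independent of \<open>n\<close>, which the constant \<open>d\<close> absorbs.\<close>

lemma eventually_periodic_edge:
  assumes "F y {#x#} \<noteq> 0"
  shows "eventually_periodic N e u y c \<longleftrightarrow> eventually_periodic N e u x (Suc c)"
proof -
  define h where "h = of_nat (Suc (count {#x#} u)) * F y {#u, x#} / F y {#x#}"
  have *: "lam y u (Suc n) = h + lam x u n" if "n > 0" for n
    using lam_one[OF that, of y u x] assms unfolding h_def
    by (simp add: field_simps del: of_nat_Suc)
  show ?thesis
  proof
    assume "eventually_periodic N e u y c"
    then obtain d n0 where d: "\<And>n. n \<ge> n0 \<Longrightarrow> lam y u n = d + e * of_bool (N dvd n + c)"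
      unfolding eventually_periodic_def by blast
    have "lam x u n = (d - h) + e * of_bool (N dvd n + Suc c)" if "n \<ge> Suc n0" for n
      using *[of n] d[of "Suc n"] that by (simp add: algebra_simps)
    then show "eventually_periodic N e u x (Suc c)"
      unfolding eventually_periodic_def by blast
  next
    assume "eventually_periodic N e u x (Suc c)"
    then obtain d n0 where d: "\<And>n. n \<ge> n0 \<Longrightarrow> lam x u n = d + e * of_bool (N dvd n + Suc c)"
      unfolding eventually_periodic_def by blast
    have "lam y u n = (d + h) + e * of_bool (N dvd n + c)" if "n \<ge> Suc (Suc n0)" for n
    proof -
      obtain n' where n': "n = Suc n'" "n' \<ge> Suc n0" using \<open>n \<ge> Suc (Suc n0)\<close> by (cases n) auto
      then show ?thesis using *[of n'] d[of n'] by (simp add: algebra_simps)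
    qed
    then show "eventually_periodic N e u y c"
      unfolding eventually_periodic_def by blast
  qed
qed

lemma eventually_periodic_mod_cong:
  assumes "eventually_periodic N e u x c" "c mod N = c' mod N"
  shows "eventually_periodic N e u x c'"
proof -
  have "N dvd n + c \<longleftrightarrow> N dvd n + c'" for n
    using assms(2) by (metis dvd_eq_mod_eq_0 mod_add_right_eq)
  then show ?thesis using assms(1) by (simp add: eventually_periodic_def)
qed

lemma eventually_periodic_connected:
  assumes "sdse_connected F" "N > 0" "eventually_periodic N e u x0 c0"
  shows "\<exists>c. eventually_periodic N e u x c"
proof -
  have "(x0, x) \<in> (sdse_edges F \<union> (sdse_edges F)\<inverse>)\<^sup>*"
    using assms(1) by (simp add: sdse_connected_def)
  then show ?thesis
  proof induction
    case base
    then show ?case using assms by blast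
  next
    case (step y z)
    then obtain c where c: "eventually_periodic N e u y c" by blast
    from step(2) consider "F y {#z#} \<noteq> 0" | "F z {#y#} \<noteq> 0" by (auto simp: edge_iff)
    then show ?case
    proof cases
      case 1
      then show ?thesis using c eventually_periodic_edge by blast
    next
      case 2
      \<comment> \<open>Following an edge backwards lowers the phase by one;
        \<open>c + N - 1\<close> represents this within the natural numbers.\<close>
      have "eventually_periodic N e u y (Suc (c + N - 1))"
        using assms(2) by (intro eventually_periodic_mod_cong[OF c]) simp
      then show ?thesis using 2 eventually_periodic_edge by blast
    qed
  qed
qed

lemma ex_large_dvd:
  assumes "N > (0::nat)"
  shows "\<exists>n\<ge>n0. N dvd n + a"
proof -
  have "a \<le> a * N" "n0 \<le> n0 * N" using assms by auto
  then show ?thesis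
    by (intro exI[of _ "a * N - a + n0 * N"])
      (metis add.assoc add.commute dvd_add dvd_triv_right le_add2 le_add_diff_inverse le_trans)
qed

lemma eventually_periodic_unique:
  assumes "eventually_periodic N e u x c" "eventually_periodic N e u x c'"
    and "N \<ge> 2" "e \<noteq> 0"
  shows "c mod N = c' mod N"
proof (rule ccontr)
  assume neq: "c mod N \<noteq> c' mod N"
  obtain d n0 where d: "\<And>n. n \<ge> n0 \<Longrightarrow> lam x u n = d + e * of_bool (N dvd n + c)"
    using assms(1) unfolding eventually_periodic_def by blast
  obtain d' n0' where d': "\<And>n. n \<ge> n0' \<Longrightarrow> lam x u n = d' + e * of_bool (N dvd n + c')"
    using assms(2) unfolding eventually_periodic_def by blast
  have ne: False if "N dvd n + c" "N dvd n + c'" for n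
  proof -
    have "[n + c = n + c'] (mod N)" using that by (simp add: cong_def)
    then show False using neq by (simp add: cong_add_lcancel_nat) (simp add: cong_def)
  qed
  obtain n where n: "n \<ge> n0 + n0'" "N dvd n + c"
    using ex_large_dvd[of N "n0 + n0'" c] assms(3) by auto
  obtain m where m: "m \<ge> n0 + n0'" "N dvd m + c'"
    using ex_large_dvd[of N "n0 + n0'" c'] assms(3) by auto
  have "\<not> N dvd n + c'" "\<not> N dvd m + c" using ne n m by blast+
  \<comment> \<open>Where one description has its peak, the other is at its base value. Both
    comparisons together give \<open>2 * e = 0\<close>.\<close>
  then have "d + e = d'" "d' + e = d" using d[of n] d'[of n] n d[of m] d'[of m] m by auto
  then have "d + (e + e) = d + 0" by (metis add.assoc add.right_neutral)
  then have "2 * e = 0" by (simp only: add_left_cancel mult_2)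
  then show False using assms(4) by simp
qed

text \<open>A branching at \<open>x\<close> would yield a constant \<open>K\<close> with
  \<open>K + e [N \<bar> a + r] + e [N \<bar> b + r] = e [N \<bar> a + b + r]\<close> for all large \<open>a\<close>, \<open>b\<close>,
  which two choices of residues refute.\<close>

lemma eventually_periodic_linear:
  assumes "eventually_periodic N e u x c" "N \<ge> 2" "e \<noteq> 0"
  shows "F x {#v, w#} = 0"
proof (rule ccontr)
  assume nz: "F x {#v, w#} \<noteq> 0"
  then have v: "F x {#v#} \<noteq> 0" and w: "F x {#w#} \<noteq> 0"
    using zero_superset[of x "{#v#}" "{#v, w#}"] zero_superset[of x "{#w#}" "{#v, w#}"] by auto
  obtain d n0 where d: "\<And>n. n \<ge> n0 \<Longrightarrow> lam x u n = d + e * of_bool (N dvd n + c)"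
    using assms(1) unfolding eventually_periodic_def by blast
  define h where "h k = of_nat (Suc (count {#k#} u)) * F x {#u, k#} / F x {#k#}" for k
  have one: "lam x u (Suc n) = h k + lam k u n" if "n > 0" "F x {#k#} \<noteq> 0" for n k
    using lam_one[OF that(1), of x u k] that(2) unfolding h_def
    by (simp add: field_simps del: of_nat_Suc)
  define h2 where "h2 = of_nat (Suc (count {#v, w#} u)) * F x {#u, v, w#} / F x {#v, w#}"
  have two: "lam x u (Suc (a + b)) = h2 + lam v u a + lam w u b" if "a > 0" "b > 0" for a b
    using lam_two[OF that, of x u v w] nz unfolding h2_def
    by (simp add: field_simps del: of_nat_Suc)
  define K where "K = h2 - h v - h w + d"
  define r where "r = Suc c"
  \<comment> \<open>\<open>lam_one\<close> expresses the sequences of \<open>v\<close> and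
    \<open>w\<close> through that of \<open>x\<close>; inserted into \<open>lam_two\<close>, they
    leave a relation on the sequence of \<open>x\<close> alone.\<close>
  have K: "K + e * of_bool (N dvd a + r) + e * of_bool (N dvd b + r) = e * of_bool (N dvd a + b + r)"
    if "a \<ge> Suc n0" "b \<ge> Suc n0" for a b
  proof -
    have "d + e * of_bool (N dvd a + r) = h v + lam v u a"
      "d + e * of_bool (N dvd b + r) = h w + lam w u b"
      "d + e * of_bool (N dvd a + b + r) = h2 + lam v u a + lam w u b"
      using one[of a v] one[of b w] two[of a b] d[of "Suc a"] d[of "Suc b"] d[of "Suc (a + b)"] that v w
      by (simp_all add: r_def)
    then show ?thesis unfolding K_def by algebra
  qed
  obtain A where A: "A \<ge> Suc n0" "N dvd A + r"
    using ex_large_dvd[of N "Suc n0" r] assms(2) by auto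
  obtain Z where Z: "Z \<ge> Suc n0" "N dvd Z"
    using ex_large_dvd[of N "Suc n0" 0] assms(2) by auto
  show False
  proof (cases "N dvd r")
    \<comment> \<open>For \<open>r\<close> divisible by \<open>N\<close>, choosing \<open>a\<close>
      and \<open>b\<close> both congruent to 0 gives \<open>K = - e\<close>, while the residues 1
      and -1 give \<open>K = e\<close>.\<close>
    case True
    then have "N dvd A" using A(2) by (simp add: dvd_add_left_iff)
    then have "K + e + e = e" using K[OF A(1) A(1)] True by simp
    moreover have "\<not> N dvd Suc Z + r" "\<not> N dvd (Z + (N - 1)) + r" "N dvd Suc Z + (Z + (N - 1)) + r"
    proof -
      have "\<not> N dvd 1" "\<not> N dvd N - 1" using assms(2) by (auto dest: dvd_imp_le)
      moreover have "Suc Z + r = 1 + (Z + r)" "Z + (N - 1) + r = (N - 1) + (Z + r)"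
        "Suc Z + (Z + (N - 1)) + r = N + (Z + (Z + r))"
        using assms(2) by auto
      ultimately show "\<not> N dvd Suc Z + r" "\<not> N dvd (Z + (N - 1)) + r"
        "N dvd Suc Z + (Z + (N - 1)) + r"
        using True Z(2) by (simp_all only: dvd_add_left_iff dvd_add dvd_refl) simp_all
    qed
    then have "K = e" using K[of "Suc Z" "Z + (N - 1)"] Z(1) by simp
    ultimately have "e + (e + e) = e + 0" by (metis add.assoc add.right_neutral)
    then have "2 * e = 0" by (simp only: add_left_cancel mult_2)
    then show False using assms(3) by simp
  next
    \<comment> \<open>Otherwise \<open>a\<close> and \<open>b\<close> both congruent to
      \<open>- r\<close> give \<open>K = - 2 * e\<close>, while the residues 0 and
      \<open>- r\<close> give \<open>K = 0\<close>.\<close>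
    case False
    then have "\<not> N dvd A" using A(2) by (auto simp: dvd_add_right_iff)
    then have "\<not> N dvd A + A + r" using A(2) by (simp add: add.assoc dvd_add_left_iff)
    then have "K + e + e = 0" using K[OF A(1) A(1)] A(2) by simp
    moreover have "N dvd Z + A + r" using Z(2) A(2) by (simp add: add.assoc)
    moreover have "\<not> N dvd Z + r" using Z(2) False by (simp add: dvd_add_right_iff)
    ultimately have "2 * e = 0" using K[OF Z(1) A(1)] A(2) by simp
    then show False using assms(3) by simp
  qed
qed

section \<open>From the multicyclic part to the whole system\<close>

text \<open>Inside \<open>J\<close> there are no quadratic terms, so \<open>lam_one\<close> passes
  from \<open>i\<close> to any \<open>j\<close> in the next class without an extra summand.
  Iteration ends at \<open>lam1\<close>, which tests whether \<open>u\<close> lies in the class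
  reached.\<close>

lemma lam_multicyclic:
  assumes P: "cyclic_partition N J P" and l: "\<forall>j\<in>J. l j \<noteq> 0"
    and FJ: "\<forall>k<N. \<forall>i\<in>P k. rescale l (restrict_series J (F i)) =
      one_plus_linear (P (Suc k mod N)) (\<lambda>_. 1)"
    and "k < N" "i \<in> P k" "ku < N" "u \<in> P ku" "n > 0"
  shows "lam i u n = of_bool ((k + n) mod N = ku) / l u"
proof -
  have sub: "P k \<subseteq> J" if "k < N" for k
    using P that by (auto simp: cyclic_partition_def)
  have disj: "P k \<inter> P k' = {}" if "k < N" "k' < N" "k \<noteq> k'" for k k'
    using P that by (auto simp: cyclic_partition_def)
  have one: "F i {#j#} = of_bool (j \<in> P (Suc k mod N)) / l j" if "k < N" "i \<in> P k" "j \<in> J" for i j k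
  proof -
    have "rescale l (restrict_series J (F i)) {#j#} = one_plus_linear (P (Suc k mod N)) (\<lambda>_. 1) {#j#}"
      using FJ that by simp
    then show ?thesis
      using l that by (auto simp: rescale_def restrict_series_def one_plus_linear_def field_simps)
  qed
  have two: "F i {#j, j'#} = 0" if "k < N" "i \<in> P k" "j \<in> J" "j' \<in> J" for i j j' k
  proof -
    have "rescale l (restrict_series J (F i)) {#j, j'#} =
        one_plus_linear (P (Suc k mod N)) (\<lambda>_. 1) {#j, j'#}"
      using FJ that by simp
    then show ?thesis
      using l that by (auto simp: rescale_def restrict_series_def one_plus_linear_def)
  qed
  have uJ: "u \<in> J" using sub assms by blast
  show ?thesis
    using \<open>n > 0\<close> \<open>k < N\<close> \<open>i \<in> P k\<close>
  proof (induction n arbitrary: k i)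
    case (Suc n)
    let ?k = "Suc k mod N"
    have k: "?k < N" using Suc.prems by simp
    show ?case
    proof (cases "n = 0")
      case True
      have "u \<in> P ?k \<longleftrightarrow> ?k = ku" using disj[OF k \<open>ku < N\<close>] \<open>u \<in> P ku\<close> by blast
      then show ?thesis using one[OF Suc.prems(2,3) uJ] lam1[of i u] True by simp
    next
      case False
      obtain j where j: "j \<in> P ?k" using P k unfolding cyclic_partition_def by blast
      then have jJ: "j \<in> J" using sub[OF k] by blast
      have "lam j u n = of_bool ((?k + n) mod N = ku) / l u"
        using Suc.IH[OF _ k j] False by simp
      moreover have "lam i u (Suc n) = lam j u n"
        using lam_one[of n i u j] one[OF Suc.prems(2,3) jJ] two[OF Suc.prems(2,3) uJ jJ] j l jJ False
        by simp
      ultimately show ?thesis by (simp add: mod_simps)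
    qed
  qed simp
qed

text \<open>Every monomial of degree at least two contains a quadratic one, so
  \<open>zero_superset\<close> kills its coefficient.\<close>

lemma linear_form:
  assumes "\<And>v w. F x {#v, w#} = 0"
  shows "F x = one_plus_linear (descendants F x) (\<lambda>j. F x {#j#})"
proof
  fix m :: "'i multiset"
  consider "m = {#}" | j where "m = {#j#}" | v w m' where "m = add_mset v (add_mset w m')"
    by (metis multiset_cases)
  then show "F x m = one_plus_linear (descendants F x) (\<lambda>j. F x {#j#}) m"
  proof cases
    case 1
    then show ?thesis by (simp add: one_plus_linear_def F0)
  next
    case (2 j)
    have "(\<Sum>i\<in>descendants F x. F x {#i#} * (if j = i then 1 else 0)) = F x {#j#}"
      by (simp add: descendants_iff if_distrib cong: if_cong)
    then show ?thesis using 2 by (simp add: one_plus_linear_def)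
  next
    case (3 v w m')
    then have "F x m = 0" using zero_superset[OF assms[of v w], of m] by simp
    then show ?thesis using 3 by (simp add: one_plus_linear_def)
  qed
qed

theorem multicyclic_structure:
  assumes conn: "sdse_connected F" and N: "N \<ge> 2" and "contains_multicyclic N F"
  shows "(\<exists>P. cyclic_partition N UNIV P \<and>
             (\<forall>k<N. \<forall>x\<in>P k. descendants F x \<subseteq> P (Suc k mod N)) \<and>
             (\<forall>x x'. (\<exists>z. x \<in> descendants F z \<and> x' \<in> descendants F z) \<longrightarrow>
                     descendants F x = descendants F x')) \<and>
         (\<forall>x. \<exists>a. F x = one_plus_linear (descendants F x) a) \<and>
         (\<forall>x x'. (\<exists>z. x \<in> descendants F z \<and> x' \<in> descendants F z) \<longrightarrow> F x = F x')"
proof -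
  obtain J P0 l where J: "J \<noteq> {}" and P0: "cyclic_partition N J P0" and l: "\<forall>j\<in>J. l j \<noteq> 0"
    and FJ: "\<forall>k<N. \<forall>i\<in>P0 k. rescale l (restrict_series J (F i)) =
      one_plus_linear (P0 (Suc k mod N)) (\<lambda>_. 1)"
    using assms(3) by (auto simp: contains_multicyclic_def multicyclic_def)
  have N0: "0 < N" using N by simp
  \<comment> \<open>A reference vertex of class 0: all other vertices are classified by the phase of
    their sequence relative to it.\<close>
  obtain u where u: "u \<in> P0 0" using P0 N0 unfolding cyclic_partition_def by blast
  then have uJ: "u \<in> J" using P0 N by (force simp: cyclic_partition_def)
  define e where "e = 1 / l u"
  have e: "e \<noteq> 0" using l uJ by (simp add: e_def)
  define per where "per = eventually_periodic N e u"
  have perJ: "per x k" if "k < N" "x \<in> P0 k" for x k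
  proof -
    have "lam x u n = 0 + e * of_bool (N dvd n + k)" if "n \<ge> 1" for n
    proof -
      have "lam x u n = of_bool ((k + n) mod N = 0) / l u"
        using lam_multicyclic[OF P0 l FJ \<open>k < N\<close> \<open>x \<in> P0 k\<close> _ u, of n] N that by simp
      then show ?thesis by (simp add: e_def dvd_eq_mod_eq_0 add.commute)
    qed
    then show ?thesis unfolding per_def eventually_periodic_def by blast
  qed
  have ex: "\<exists>c. per x c" for x
    using eventually_periodic_connected[OF conn, of N e u] perJ[of 0 u] u N unfolding per_def by simp
  have unique: "c mod N = c' mod N" if "per x c" "per x c'" for x c c'
    using eventually_periodic_unique that N e unfolding per_def by blast
  have lin: "F x {#v, w#} = 0" for x v w
    using eventually_periodic_linear ex[of x] N e unfolding per_def by blast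
  have form: "F x = one_plus_linear (descendants F x) (\<lambda>j. F x {#j#})" for x
    by (rule linear_form) (rule lin)
  have sib: "F x = F x'" if "x \<in> descendants F z" "x' \<in> descendants F z" for x x' z
  proof -
    \<comment> \<open>Without quadratic terms, \<open>lam_one\<close> at \<open>n = 1\<close>
      equates \<open>lam z j 2\<close> with \<open>lam x j 1\<close>, whatever the descendant
      \<open>x\<close> of \<open>z\<close>.\<close>
    have "F x {#j#} = lam z j 2" if "x \<in> descendants F z" for x j
      using lam_one[of 1 z j x] that lin lam1[of x j]
      by (simp add: descendants_iff numeral_2_eq_2)
    then have *: "F x {#j#} = F x' {#j#}" for j using that by metis
    then have "descendants F x = descendants F x'" by (auto simp: descendants_iff)
    then show ?thesis using form[of x] form[of x'] * by simp
  qed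
  define P where "P k = {x. per x k}" for k
  have part: "cyclic_partition N UNIV P"
    unfolding cyclic_partition_def
  proof (intro conjI allI impI)
    show "(\<Union>k<N. P k) = UNIV"
    proof -
      have "\<exists>k<N. per x k" for x
      proof -
        obtain c where "per x c" using ex by blast
        then have "per x (c mod N)"
          using eventually_periodic_mod_cong unfolding per_def by simp
        then show ?thesis using N by (intro exI[of _ "c mod N"]) auto
      qed
      then show ?thesis by (auto simp: P_def)
    qed
    show "P k \<noteq> {}" if "k < N" for k
    proof -
      obtain x where "x \<in> P0 k" using P0 \<open>k < N\<close> unfolding cyclic_partition_def by blast
      then have "x \<in> P k" using perJ[OF that] by (simp add: P_def)
      then show ?thesis by blast
    qed
    show "P k \<inter> P k' = {}" if "k < N" "k' < N" "k \<noteq> k'" for k k'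
    proof -
      have False if "per x k" "per x k'" for x
        using unique[OF that] \<open>k < N\<close> \<open>k' < N\<close> \<open>k \<noteq> k'\<close> by simp
      then show ?thesis by (auto simp: P_def)
    qed
  qed
  have desc: "descendants F x \<subseteq> P (Suc k mod N)" if "x \<in> P k" for x k
  proof
    fix y assume "y \<in> descendants F x"
    then have "per y (Suc k)"
      using eventually_periodic_edge[of x y N e u k] that
      by (simp add: P_def per_def descendants_iff)
    then show "y \<in> P (Suc k mod N)"
      using eventually_periodic_mod_cong[of N e u y "Suc k" "Suc k mod N"]
      by (simp add: per_def P_def)
  qed
  have same: "descendants F x = descendants F x'"
    if "x \<in> descendants F z" "x' \<in> descendants F z" for x x' z
    using sib[OF that] by (simp add: descendants_def sdse_edges_def)
  show ?thesis
  proof (intro conjI allI impI)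
    show "\<exists>P. cyclic_partition N UNIV P \<and>
             (\<forall>k<N. \<forall>x\<in>P k. descendants F x \<subseteq> P (Suc k mod N)) \<and>
             (\<forall>x x'. (\<exists>z. x \<in> descendants F z \<and> x' \<in> descendants F z) \<longrightarrow>
                     descendants F x = descendants F x')"
      by (rule exI[of _ P]) (intro conjI allI impI ballI part desc, auto dest: same)
    show "\<exists>a. F x = one_plus_linear (descendants F x) a" for x
      by (rule exI, rule form)
    show "F x = F x'" if "\<exists>z. x \<in> descendants F z \<and> x' \<in> descendants F z" for x x'
      using that sib by (elim exE conjE)
  qed
qed

end

section \<open>Hopf systems satisfy the leaf-grafting identities\<close>

lemma hopf_leaf_system:
  fixes F :: "'i::finite \<Rightarrow> ('i, 'k::field_char_0) series"
  assumes nonconst: "\<And>i. nonconstant (F i)" and F0: "\<And>i. F i {#} = 1" and "hopf_sdse F"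
  shows "\<exists>lam. leaf_system F lam"
proof -
  \<comment> \<open>There is no tree with 0 vertices, so the value at \<open>n = 0\<close> is
    arbitrary; this is why the locale asks for positive sizes.\<close>
  define lam where "lam i j n = (SOME c. \<forall>s\<in>trees i n.
    (\<Sum>t\<in>trees i (Suc n). tree_coef F t * lookup (cut_leaf j t) {#s#}) = c * tree_coef F s)" for i j n
  have lam: "(\<Sum>t\<in>trees i (Suc n). tree_coef F t * lookup (cut_leaf j t) {#s#}) = lam i j n * tree_coef F s"
    if "s \<in> trees i n" for i j n s
  proof -
    have "\<exists>c. \<forall>s\<in>trees i n. (\<Sum>t\<in>trees i (Suc n). tree_coef F t * lookup (cut_leaf j t) {#s#}) =
        c * tree_coef F s"
      using hopf_tree_identity[OF \<open>hopf_sdse F\<close>, of i n "{#Node j {#}#}"]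
      by (simp only: lookup_coprod_tree)
    from someI_ex[OF this, folded lam_def] show ?thesis using that by blast
  qed
  have *: "lam i j (Suc (forest_deg f)) * F i (rlabels f) =
      of_nat (Suc (count (rlabels f) j)) * F i (add_mset j (rlabels f)) +
      F i (rlabels f) * (\<Sum>t\<in>#f. lam (rlabel t) j (nverts t))"
    if "\<And>t. t \<in># f \<Longrightarrow> tree_coef F t \<noteq> 0" for i j f
    by (rule leaf_identity[where lam = "\<lambda>i. lam i j"]) (use F0 lam that in auto)
  have leaf: "tree_coef F (Node k {#}) = 1" for k by (simp add: F0)
  \<comment> \<open>The identity for the corolla whose leaves are decorated by \<open>m\<close>
    loses all terms containing \<open>F i m\<close>, leaving a nonzero multiple of the larger
    coefficient.\<close>
  have hereditary: "F i (add_mset j m) = 0" if "F i m = 0" for i j m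
  proof -
    define f where "f = image_mset (\<lambda>k. Node k {#}) m"
    have "rlabels f = m" by (simp add: f_def multiset.map_comp o_def)
    moreover have "tree_coef F t \<noteq> 0" if "t \<in># f" for t using that leaf by (auto simp: f_def)
    ultimately show ?thesis using *[of f i j] that by (simp del: of_nat_Suc)
  qed
  \<comment> \<open>A nonconstant series has a nonzero nontrivial monomial, and by heredity each
    variable in it occurs linearly.\<close>
  have "\<exists>j. F i {#j#} \<noteq> 0" for i
  proof -
    obtain m where m: "m \<noteq> {#}" "F i m \<noteq> 0" using nonconst[of i] by (auto simp: nonconstant_def)
    then obtain j m' where j: "m = m' + {#j#}" by (metis multiset_cases add_mset_add_single)
    have "F i (m' + {#j#}) = 0" if "F i {#j#} = 0"
      by (induction m') (auto simp: that hereditary add_mset_commute[of j])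
    then show ?thesis using m j by auto
  qed
  \<comment> \<open>Since every vertex has a direct descendant, grafting one root at a time builds
    ladders of every positive size with nonzero coefficient.\<close>
  then have ex_tree: "\<exists>t\<in>trees i (Suc n). tree_coef F t \<noteq> 0" for i n
  proof (induction n arbitrary: i)
    case 0
    show ?case by (rule bexI[of _ "Node i {#}"]) (auto simp: leaf trees_def simp del: tree_coef.simps)
  next
    case (Suc n)
    obtain k where k: "F i {#k#} \<noteq> 0" using Suc.prems by blast
    obtain t where t: "t \<in> trees k (Suc n)" "tree_coef F t \<noteq> 0" using Suc by blast
    have "tree_coef F (Node i {#t#}) \<noteq> 0"
      using k t forest_coef_nonzero[of "{#t#}" F] by (simp add: tree_coef_Node trees_def del: tree_coef.simps)
    then show ?case using t(1) by (intro bexI[of _ "Node i {#t#}"]) (auto simp: trees_def)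
  qed
  have "leaf_system F lam"
  proof
    show "lam i j 1 = F i {#j#}" for i j
      using *[of "{#}" i j] by (simp add: F0)
    show "lam i j (Suc n) * F i {#k#} = of_nat (Suc (count {#k#} j)) * F i {#j, k#} + F i {#k#} * lam k j n"
      if "n > 0" for n i j k
    proof -
      obtain t where t: "t \<in> trees k n" "tree_coef F t \<noteq> 0"
        using ex_tree[of k "n - 1"] \<open>n > 0\<close> by auto
      then show ?thesis using *[of "{#t#}" i j] by (simp add: trees_def del: of_nat_Suc)
    qed
    show "lam i j (Suc (a + b)) * F i {#v, w#} =
        of_nat (Suc (count {#v, w#} j)) * F i {#j, v, w#} + F i {#v, w#} * (lam v j a + lam w j b)"
      if "a > 0" "b > 0" for a b i j v w
    proof -
      obtain t where t: "t \<in> trees v a" "tree_coef F t \<noteq> 0"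
        using ex_tree[of v "a - 1"] \<open>a > 0\<close> by auto
      obtain t' where t': "t' \<in> trees w b" "tree_coef F t' \<noteq> 0"
        using ex_tree[of w "b - 1"] \<open>b > 0\<close> by auto
      have "tree_coef F s \<noteq> 0" if "s \<in># {#t, t'#}" for s using that t t' by auto
      from *[of "{#t, t'#}" i j, OF this] show ?thesis
        using t t' by (simp add: trees_def del: of_nat_Suc)
    qed
  qed (use assms hereditary in auto)
  then show ?thesis by blast
qed

theorem theorem51:
  fixes F :: "'i::finite \<Rightarrow> ('i, 'k::field_char_0) series" and N :: nat
  assumes "\<And>i. nonconstant (F i)"
    and "\<And>i. F i {#} = 1"
    and "sdse_connected F"
    and "hopf_sdse F"
    and "N \<ge> 2"
    and "contains_multicyclic N F"
  shows "(\<exists>P. cyclic_partition N UNIV P \<and>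
             (\<forall>k<N. \<forall>x\<in>P k. descendants F x \<subseteq> P (Suc k mod N)) \<and>
             (\<forall>x x'. (\<exists>z. x \<in> descendants F z \<and> x' \<in> descendants F z) \<longrightarrow>
                     descendants F x = descendants F x')) \<and>
         (\<forall>x. \<exists>a. F x = one_plus_linear (descendants F x) a) \<and>
         (\<forall>x x'. (\<exists>z. x \<in> descendants F z \<and> x' \<in> descendants F z) \<longrightarrow> F x = F x')"
proof -
  obtain lam where "leaf_system F lam" using hopf_leaf_system assms(1,2,4) by blast
  then show ?thesis by (rule leaf_system.multicyclic_structure) (rule assms(3,5,6))+
qed

end
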